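(* Let $n\ge 2$ and let $\mathbf{p}=(\mathbf{p}_1,\dots,\mathbf{p}_N)$, $\mathbf{q}=(\mathbf{q}_1,\dots,\mathbf{q}_N)$ be configurations of points in $\mathbb{E}^n$ with $|\mathbf{p}_i-\mathbf{p}_j|\le|\mathbf{q}_i-\mathbf{q}_j|$ for all $1\le i<j\le N$. Then $$M_n[\mathrm{Conv}\{\mathbf{q}_1,\dots,\mathbf{q}_N\}]\ge M_n[\mathrm{Conv}\{\mathbf{p}_1,\dots,\mathbf{p}_N\}],$$ and if $\mathbf{p}$ and $\mathbf{q}$ are not congruent, the inequality is strict.
   Context: For a compact convex set $K\subset\mathbb{E}^n$, its (unnormalized) mean width is $M_n[K]=\int_{S^{n-1}}\max\{\langle x,u\rangle: x\in K\}\,d\sigma(u)$, where $\sigma$ is the Lebesgue (surface) measure on the unit sphere $S^{n-1}$ and $\langle\cdot,\cdot\rangle$ is the standard inner product. $\mathrm{Conv}$ denotes convex hull. Congruent means there is an isometry of $\mathbb{E}^n$ mapping $\mathbf{p}_i$ to $\mathbf{q}_i$ for every $i$. *)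

theory Defs
  imports "HOL-Analysis.Analysis"
begin

text \<open>Surface (Lebesgue) measure on the unit sphere S^{n-1}, defined as the cone measure:
  sigma(A) = n * lambda_n({t u : u in A, 0 < t <= 1}), which coincides with the
  (n-1)-dimensional Hausdorff/surface measure on the sphere.\<close>
definition sphere_surface_measure :: "'a::euclidean_space measure" where
  "sphere_surface_measure =
     measure_of (sphere 0 1) (sets (restrict_space borel (sphere 0 1)))
       (\<lambda>A. of_nat DIM('a) * emeasure lborel {t *\<^sub>R u | t u. u \<in> A \<and> 0 < t \<and> t \<le> 1})"

definition support_fun :: "'a::euclidean_space set \<Rightarrow> 'a \<Rightarrow> real" where
  "support_fun K u = Sup ((\<lambda>x. inner x u) ` K)"

definition mean_width :: "'a::euclidean_space set \<Rightarrow> real" where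
  "mean_width K = integral\<^sup>L sphere_surface_measure (support_fun K)"

definition congruent_config :: "nat \<Rightarrow> (nat \<Rightarrow> 'a::euclidean_space) \<Rightarrow> (nat \<Rightarrow> 'a) \<Rightarrow> bool" where
  "congruent_config N p q \<longleftrightarrow>
     (\<exists>f::'a \<Rightarrow> 'a. (\<forall>x y. dist (f x) (f y) = dist x y) \<and> (\<forall>i<N. f (p i) = q i))"

end

theory Submission
  imports Defs "HOL-Probability.Probability"
begin

text \<open>
  Up to a positive constant depending only on the dimension, the mean width of the hull of
  \<open>p\<^sub>1, \<dots>, p\<^sub>N\<close> is the Gaussian expectation of \<open>max\<^sub>i \<langle>p\<^sub>i, g\<rangle>\<close>. Interpolate in the doubled
  space between the configurations \<open>(p\<^sub>i, 0)\<close> and \<open>(0, q\<^sub>i)\<close> along \<open>(cos \<theta> p\<^sub>i, sin \<theta> q\<^sub>i)\<close>,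
  replacing the maximum by \<open>ln (\<Sum>\<^sub>i exp (\<beta> y\<^sub>i)) / \<beta>\<close>. Gaussian integration by parts gives the
  \<open>\<theta>\<close>-derivative
  \<open>\<beta> sin \<theta> cos \<theta> / 2 \<cdot> \<Sum>\<^sub>i\<^sub>j (|q\<^sub>i - q\<^sub>j|\<^sup>2 - |p\<^sub>i - p\<^sub>j|\<^sup>2) E[w\<^sub>i w\<^sub>j]\<close>
  with softmax weights \<open>w\<close> (the Sudakov--Fernique argument), hence the inequality.

  For strictness, consider the polytope \<open>P\<close> spanned by the points \<open>(p\<^sub>i, q\<^sub>i)\<close>. If \<open>i, j\<close> span an
  edge of \<open>P\<close>, then \<open>\<beta> E[w\<^sub>i w\<^sub>j]\<close> stays bounded away from 0 as \<open>\<beta> \<rightarrow> \<infinity>\<close>, since the weights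
  are bounded below in a slab of width of order \<open>1/\<beta>\<close>; so in the case of equality the quadratic form
  \<open>Q (x, y) = |y|\<^sup>2 - |x|\<^sup>2\<close> vanishes on all edges of \<open>P\<close>. As \<open>Q\<close> is nonnegative on
  differences of vertices, induction over the faces shows that it vanishes on all such differences, and
  the two configurations are congruent.
\<close>

section \<open>Quadratic forms on polytopes\<close>

text \<open>The right side lies in the left because \<open>F1\<close> lies in the hyperplane, and
  the dimensions agree: passing to a facet costs exactly one dimension, and the hyperplane cuts the
  span properly because some point of \<open>F\<close> lies off \<open>F1\<close>.\<close>

lemma span_facet_directions:
  fixes F :: "'v::euclidean_space set"
  assumes "F1 facet_of F" "f \<in> F1" "F \<subseteq> {x. u \<bullet> x \<le> \<alpha>}" "F1 = F \<inter> {x. u \<bullet> x = \<alpha>}" "F1 \<noteq> F"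
  shows "span ((+) (- f) ` F) \<inter> {x. u \<bullet> x = 0} = span ((+) (- f) ` F1)"
proof -
  let ?W = "span ((+) (- f) ` F)" and ?K = "span ((+) (- f) ` F1)"
  have sub: "F1 \<subseteq> F" using assms(4) by auto
  have dims: "int (dim ?K) = int (dim ?W) - 1"
    using assms(1,2) sub aff_dim_eq_dim[of f F] aff_dim_eq_dim[of f F1]
    by (simp add: facet_of_def hull_inc subset_iff)
  have subs: "subspace (?W \<inter> {x. u \<bullet> x = 0})"
    by (intro subspace_inter subspace_span subspace_hyperplane)
  have "?K \<subseteq> ?W \<inter> {x. u \<bullet> x = 0}"
  proof (rule span_minimal[OF _ subs])
    have "u \<bullet> f = \<alpha>" using assms(2,4) by auto
    then show "(+) (- f) ` F1 \<subseteq> ?W \<inter> {x. u \<bullet> x = 0}"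
      using assms(4) sub by (auto simp: inner_diff_right intro!: span_base)
  qed
  moreover have "dim (?W \<inter> {x. u \<bullet> x = 0}) < dim ?W"
  proof -
    obtain s where s: "s \<in> F" "u \<bullet> s \<noteq> \<alpha>" using assms(4,5) by blast
    have "s - f \<in> ?W" using s by (intro span_base) (auto simp: image_iff)
    moreover have "s - f \<notin> {x. u \<bullet> x = 0}"
      using s assms(2,4) by (auto simp: inner_diff_right)
    ultimately have "?W \<inter> {x. u \<bullet> x = 0} \<subset> ?W" by blast
    then show ?thesis using dim_psubset[of "?W \<inter> {x. u \<bullet> x = 0}" ?W]
      by (metis subs span_eq_iff span_span)
  qed
  ultimately show ?thesis
    using dims subspace_dim_equal[OF subspace_span[of "(+) (- f) ` F1"] subs] by auto
qed

text \<open>A vertex is the intersection of the facets through it, whereas \<open>F1\<close> has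
  dimension at least 1; so some facet \<open>F2\<close> other than \<open>F1\<close> passes through
  \<open>f\<close>. Facets have equal dimension, so \<open>F2\<close> is not inside
  \<open>F1\<close>, and by Krein-Milman one of its vertices is not either.\<close>

lemma polytope_vertex_other_facet:
  fixes F :: "'v::euclidean_space set"
  assumes "polytope F" "2 \<le> aff_dim F" "F1 facet_of F" "f extreme_point_of F"
  obtains F2 s where "F2 facet_of F" "f \<in> F2" "s extreme_point_of F2" "s \<notin> F1"
proof -
  have sing: "{f} face_of F" using assms(4) by (simp add: face_of_singleton)
  have "{f} \<noteq> F" using assms(2) by auto
  then have eq: "{f} = \<Inter>{h. h facet_of F \<and> {f} \<subseteq> h}"
    by (intro face_of_polyhedron[OF polytope_imp_polyhedron[OF assms(1)] sing]) auto
  have "aff_dim F1 \<ge> 1" using assms(2,3) by (simp add: facet_of_def)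
  then have "\<not> F1 \<subseteq> {f}" using aff_dim_subset[of F1 "{f}"] by auto
  then obtain F2 where F2: "F2 facet_of F" "f \<in> F2" "F2 \<noteq> F1"
    using eq by (smt (verit, ccfv_threshold) Inter_iff insert_subset mem_Collect_eq subsetI)
  have "\<not> F2 \<subseteq> F1"
  proof
    assume "F2 \<subseteq> F1"
    then have "F2 face_of F1"
      using F2(1) assms(3) face_of_imp_subset face_of_subset unfolding facet_of_def by metis
    then have "aff_dim F2 < aff_dim F1"
      using face_of_aff_dim_lt F2(3) assms(3) unfolding facet_of_def by (metis face_of_imp_convex)
    then show False using F2(1) assms(3) by (simp add: facet_of_def)
  qed
  moreover have "polytope F2" "convex F1"
    using F2(1) assms face_of_polytope_polytope face_of_imp_convex unfolding facet_of_def by auto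
  ultimately have "\<not> {x. x extreme_point_of F2} \<subseteq> F1"
    using Krein_Milman_Minkowski[of F2] hull_minimal[of "{x. x extreme_point_of F2}" F1 convex]
    by (metis polytope_imp_compact polytope_imp_convex)
  then show thesis using that F2 by blast
qed

text \<open>As the form vanishes on a facet, on the directions of \<open>F\<close> it is a product of the facet
  functional and a second linear functional. Positivity on pairs of vertices makes these two
  comonotone between vertices on and off the facet, while vertices on and off the facet that share
  another facet have difference of form zero; this forces the second functional to vanish.\<close>
lemma quadratic_form_zero_on_polytope:
  fixes F :: "'v::euclidean_space set" and A :: "'v \<Rightarrow> 'v"
  assumes A: "linear A" "\<And>x y. A x \<bullet> y = x \<bullet> A y"
    and F: "polytope F" "2 \<le> aff_dim F"
    and pos: "\<And>a b. a extreme_point_of F \<Longrightarrow> b extreme_point_of F \<Longrightarrow> 0 \<le> A (a - b) \<bullet> (a - b)"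
    and facets: "\<And>G a b. G facet_of F \<Longrightarrow> a \<in> G \<Longrightarrow> b \<in> G \<Longrightarrow> A (a - b) \<bullet> (a - b) = 0"
    and ab: "a \<in> F" "b \<in> F"
  shows "A (a - b) \<bullet> (a - b) = 0"
proof -
  interpret A: linear A by fact
  obtain F1 where F1: "F1 facet_of F"
    using polytope_facet_exists[of F] F by auto
  then have F1f: "F1 face_of F" "F1 \<noteq> F" "F1 \<noteq> {}" by (auto simp: facet_of_def)
  obtain u \<alpha> where u: "F \<subseteq> {x. u \<bullet> x \<le> \<alpha>}" "F1 = F \<inter> {x. u \<bullet> x = \<alpha>}"
    using exposed_face_of_polyhedron[OF polytope_imp_polyhedron[OF F(1)], of F1] F1f
    unfolding exposed_face_of_def by auto
  have F1p: "polytope F1" using F(1) F1f face_of_polytope_polytope by blast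
  obtain f where f: "f extreme_point_of F1"
    using extreme_point_exists_convex[of F1] F1p F1f polytope_imp_compact polytope_imp_convex by blast
  have ext1: "x extreme_point_of F \<and> x \<in> F1" if "x extreme_point_of F1" for x
    using that extreme_point_of_face[OF F1f(1)] by blast
  obtain F2 s where F2: "F2 facet_of F" "f \<in> F2" "s extreme_point_of F2" "s \<notin> F1"
    using polytope_vertex_other_facet[OF F F1, of f] ext1 f by blast
  have ext2: "x extreme_point_of F \<and> x \<in> F2" if "x extreme_point_of F2" "F2 facet_of F" for x F2
    using that extreme_point_of_face unfolding facet_of_def by blast
  have lless: "u \<bullet> x < \<alpha>" if "x \<in> F" "x \<notin> F1" for x using u that by force
  have sF: "s \<in> F" using ext2[OF F2(3,1)] by (simp add: extreme_point_of_def)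
  \<comment> \<open>\<open>s\<close> and \<open>f\<close> share the facet \<open>F2\<close>, so the
    form vanishes on \<open>e\<close>; as \<open>s\<close> lies off \<open>F1\<close>, the direction
    \<open>e\<close> is transversal to \<open>F1\<close>.\<close>
  define e where "e = s - f"
  have ue: "u \<bullet> e < 0" using lless[OF sF F2(4)] ext1[OF f] u by (auto simp: e_def inner_diff_right)
  have Ae: "A e \<bullet> e = 0"
    using facets[OF F2(1), of s f] F2 ext2 unfolding e_def by blast
  let ?W = "span ((+) (- f) ` F)" and ?K = "span ((+) (- f) ` F1)"
  have fF1: "f \<in> F1" using f ext1 by auto
  have WK: "?W \<inter> {x. u \<bullet> x = 0} = ?K"
    by (rule span_facet_directions[OF F1 fF1 u F1f(2)])
  \<comment> \<open>Polarization: the vanishing of the form on all differences of points of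
    \<open>F1\<close> kills the associated bilinear form on generators, and then on the span by
    linearity in each argument.\<close>
  have K0: "A k \<bullet> k' = 0" if "k \<in> ?K" "k' \<in> ?K" for k k'
  proof -
    have base: "A (x - f) \<bullet> (y - f) = 0" if "x \<in> F1" "y \<in> F1" for x y
    proof -
      have polar: "A (v - w) \<bullet> (v - w) = A v \<bullet> v + A w \<bullet> w - 2 * (A v \<bullet> w)" for v w
        using A(2)[of w v] by (simp add: A.diff inner_diff inner_commute)
      have "A (x - y) \<bullet> (x - y) = A ((x - f) - (y - f)) \<bullet> ((x - f) - (y - f))" by simp
      also note polar
      finally show ?thesis
        using facets[OF F1] that fF1 by simp
    qed
    have "A (x - f) \<bullet> k' = 0" if "x \<in> F1" for x
    proof -
      have "k' \<in> {z. A (x - f) \<bullet> z = 0}"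
        using \<open>k' \<in> ?K\<close> span_minimal[OF _ subspace_hyperplane[of "A (x - f)"], of "(+) (- f) ` F1"] base that
        by (force simp: image_subset_iff)
      then show ?thesis by simp
    qed
    then have "k \<in> {z. A k' \<bullet> z = 0}"
      using \<open>k \<in> ?K\<close> span_minimal[OF _ subspace_hyperplane[of "A k'"], of "(+) (- f) ` F1"] A(2)
      by (force simp: image_subset_iff inner_commute)
    then show ?thesis using A(2)[of k k'] by (simp add: inner_commute)
  qed
  \<comment> \<open>Subtracting the multiple of \<open>e\<close> with the same value under
    \<open>u\<close> leaves a direction of \<open>F1\<close>.\<close>
  have decomp: "w - ((u \<bullet> w) / (u \<bullet> e)) *\<^sub>R e \<in> ?K" if "w \<in> ?W" for w
  proof -
    have "e \<in> ?W" unfolding e_def using sF by (intro span_base) (auto simp: image_iff)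
    then have "w - ((u \<bullet> w) / (u \<bullet> e)) *\<^sub>R e \<in> ?W" using that by (intro span_diff span_scale) auto
    moreover have "u \<bullet> (w - ((u \<bullet> w) / (u \<bullet> e)) *\<^sub>R e) = 0" using ue by (simp add: inner_diff_right)
    ultimately show ?thesis using WK by auto
  qed
  \<comment> \<open>With \<open>w\<close> split into \<open>c *\<^sub>R e\<close> and a direction
    \<open>k\<close> of \<open>F1\<close>, the squares of both parts vanish and only the cross term
    is left; \<open>A e\<close> may be evaluated at \<open>w\<close> instead of \<open>k\<close>
    because \<open>A e \<bullet> e = 0\<close>.\<close>
  have prod: "A w \<bullet> w = 2 * ((u \<bullet> w) / (u \<bullet> e)) * (A e \<bullet> w)" if "w \<in> ?W" for w
  proof -
    define c where "c = (u \<bullet> w) / (u \<bullet> e)"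
    define k where "k = w - c *\<^sub>R e"
    have k: "A k \<bullet> k = 0" using decomp[OF that] K0 by (simp add: k_def c_def)
    have w: "w = c *\<^sub>R e + k" by (simp add: k_def)
    have "A w \<bullet> w = 2 * c * (A e \<bullet> w)"
      unfolding w A.add A.scaleR using k Ae A(2)[of k e]
      by (simp add: inner_add inner_commute algebra_simps)
    then show ?thesis by (simp add: c_def)
  qed
  have inW: "x - y \<in> ?W" if "x \<in> F" "y \<in> F" for x y
  proof -
    have "(x - f) - (y - f) \<in> ?W" using that by (intro span_diff span_base) (auto simp: image_iff)
    then show ?thesis by simp
  qed
  \<comment> \<open>The factor in front of \<open>A e\<close> is negative, since \<open>u\<close> is
    positive on \<open>x - y\<close> and negative on \<open>e\<close>; nonnegativity of the form on
    pairs of vertices then fixes the sign of the other factor.\<close>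
  have mono: "A e \<bullet> (x - y) \<le> 0" if "x extreme_point_of F1" "y extreme_point_of F" "y \<notin> F1" for x y
  proof -
    have xy: "x \<in> F" "y \<in> F" "x \<in> F1"
      using that ext1[OF that(1)] unfolding extreme_point_of_def by blast+
    then have "u \<bullet> (x - y) > 0" using lless[OF xy(2) that(3)] xy(3) u(2) by (simp add: inner_diff_right)
    then have neg: "2 * ((u \<bullet> (x - y)) / (u \<bullet> e)) < 0" using ue by (simp add: divide_pos_neg)
    have "0 \<le> 2 * ((u \<bullet> (x - y)) / (u \<bullet> e)) * (A e \<bullet> (x - y))"
      using pos[of x y] that(2) ext1[OF that(1)] prod[OF inW[OF xy(1,2)]] by simp
    with neg show ?thesis by (meson linorder_not_le mult_neg_pos)
  qed
  \<comment> \<open>If \<open>y\<close> had a smaller value than \<open>x\<close>, take a vertex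
    \<open>t\<close> off \<open>F1\<close> that shares another facet with \<open>y\<close>. By
    \<open>mono\<close> the value at \<open>t\<close> is at least that at \<open>x\<close>, hence
    differs from that at \<open>y\<close>, and \<open>prod\<close> contradicts the vanishing of the
    form on \<open>y - t\<close>.\<close>
  have const: "A e \<bullet> x \<le> A e \<bullet> y" if x: "x extreme_point_of F1" and y: "y extreme_point_of F1" for x y
  proof (rule ccontr)
    assume less: "\<not> A e \<bullet> x \<le> A e \<bullet> y"
    obtain F3 t where F3: "F3 facet_of F" "y \<in> F3" "t extreme_point_of F3" "t \<notin> F1"
      using polytope_vertex_other_facet[OF F F1, of y] ext1 y by blast
    have t: "t extreme_point_of F" "t \<in> F3" using ext2[OF F3(3,1)] by auto
    have yt: "y \<in> F" "t \<in> F" "y \<in> F1" using t ext1[OF y] unfolding extreme_point_of_def by blast+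
    have "A e \<bullet> (y - t) < 0" using mono[OF x t(1) F3(4)] less by (simp add: inner_diff_right)
    moreover have "u \<bullet> (y - t) > 0" using lless[OF yt(2) F3(4)] yt(3) u(2) by (simp add: inner_diff_right)
    moreover have "2 * ((u \<bullet> (y - t)) / (u \<bullet> e)) * (A e \<bullet> (y - t)) = 0"
      using prod[OF inW[OF yt(1,2)]] facets[OF F3(1,2) t(2)] by simp
    ultimately show False using ue by simp
  qed
  have F1const: "A e \<bullet> x = A e \<bullet> f" if "x \<in> F1" for x
  proof -
    have "convex hull {x. x extreme_point_of F1} \<subseteq> {x. A e \<bullet> x = A e \<bullet> f}"
      using const[OF _ f] const[OF f] by (intro hull_minimal convex_hyperplane subsetI) (simp add: order_antisym)
    then show ?thesis
      using Krein_Milman_Minkowski[OF polytope_imp_compact[OF F1p] polytope_imp_convex[OF F1p]] that by blast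
  qed
  have "?K \<subseteq> {z. A e \<bullet> z = 0}"
    by (intro span_minimal subspace_hyperplane image_subsetI) (simp add: F1const inner_diff_right)
  then have Ke: "A e \<bullet> k = 0" if "k \<in> ?K" for k using that by blast
  \<comment> \<open>\<open>A e\<close> vanishes on the directions of \<open>F1\<close> and on
    \<open>e\<close>, hence on all directions of \<open>F\<close>, and the factorization
    \<open>prod\<close> makes the form zero.\<close>
  have "A e \<bullet> w = 0" if "w \<in> ?W" for w
    using Ke[OF decomp[OF that]] Ae by (simp add: inner_diff_right)
  then show ?thesis using prod[OF inW[OF ab]] inW[OF ab] by simp
qed

text \<open>Induction on the dimension of a face: faces with at most one point are trivial, on an
  edge all differences are multiples of the difference of its ends, and from dimension 2 on the
  vanishing passes from the facets to the face by \<open>quadratic_form_zero_on_polytope\<close>.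
  The whole hull is the last face.\<close>

lemma quadratic_form_zero_if_zero_on_edges:
  fixes S :: "'v::euclidean_space set" and A :: "'v \<Rightarrow> 'v"
  assumes A: "linear A" "\<And>x y. A x \<bullet> y = x \<bullet> A y"
    and S: "finite S"
    and pos: "\<And>a b. a \<in> S \<Longrightarrow> b \<in> S \<Longrightarrow> 0 \<le> A (a - b) \<bullet> (a - b)"
    and edge: "\<And>F a b. F face_of convex hull S \<Longrightarrow> F = closed_segment a b \<Longrightarrow> a \<in> S \<Longrightarrow> b \<in> S
      \<Longrightarrow> A (a - b) \<bullet> (a - b) = 0"
    and ab: "a \<in> S" "b \<in> S"
  shows "A (a - b) \<bullet> (a - b) = 0"
proof -
  interpret A: linear A by fact
  have poly: "polytope (convex hull S)" using S by (auto simp: polytope_def)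
  have "\<forall>a\<in>F. \<forall>b\<in>F. A (a - b) \<bullet> (a - b) = 0" if "F face_of convex hull S" for F
    using that
  proof (induction "nat (aff_dim F + 1)" arbitrary: F rule: less_induct)
    case less
    have pF: "polytope F" using poly less.prems face_of_polytope_polytope by blast
    have extS: "x \<in> S" if "x extreme_point_of F" for x
      using that extreme_point_of_convex_hull extreme_point_of_face[OF less.prems] by blast
    consider "aff_dim F \<le> 0" | "aff_dim F = 1" | "aff_dim F \<ge> 2" by linarith
    then show ?case
    proof cases
      case 1
      then have "aff_dim F = -1 \<or> aff_dim F = 0" using aff_dim_geq[of F] by linarith
      then have "F = {} \<or> (\<exists>a. F = {a})" by (metis aff_dim_empty aff_dim_eq_0)
      then show ?thesis by auto
    next
      case 2
      then have "F \<noteq> {}" "collinear F" by (auto simp: collinear_aff_dim)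
      then obtain a b where ab: "F = closed_segment a b"
        using compact_convex_collinear_segment[of F] pF polytope_imp_compact polytope_imp_convex by blast
      have "a \<in> S" "b \<in> S" using extS ab by (auto simp: extreme_point_of_segment)
      then have z: "A (a - b) \<bullet> (a - b) = 0" using edge[OF less.prems ab] by simp
      show ?thesis
      proof (intro ballI)
        fix x y assume "x \<in> F" "y \<in> F"
        then obtain s t where st: "x = (1 - s) *\<^sub>R a + s *\<^sub>R b" "y = (1 - t) *\<^sub>R a + t *\<^sub>R b"
          unfolding ab closed_segment_def by auto
        have "x - y = (t - s) *\<^sub>R (a - b)" unfolding st by (simp add: algebra_simps)
        then show "A (x - y) \<bullet> (x - y) = 0" using z by (simp add: A.scaleR)
      qed
    next
      case 3
      have facets: "A (x - y) \<bullet> (x - y) = 0" if "G facet_of F" "x \<in> G" "y \<in> G" for G x y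
      proof -
        have G: "G face_of convex hull S" "aff_dim G < aff_dim F"
          using that less.prems face_of_trans unfolding facet_of_def by auto
        moreover have "nat (aff_dim G + 1) < nat (aff_dim F + 1)" using G(2) 3 by linarith
        ultimately show ?thesis using less.hyps[of G] that(2,3) by blast
      qed
      show ?thesis
        by (intro ballI, rule quadratic_form_zero_on_polytope[OF A pF 3 pos[OF extS extS] facets])
    qed
  qed
  from this[OF face_of_refl] show ?thesis
    using ab hull_inc[of _ S convex] by auto
qed

section \<open>Extending isometries\<close>

text \<open>The reflection in the perpendicular bisector of \<open>a\<close> and \<open>b\<close>,
  or the identity if they coincide.\<close>

lemma reflection_swapping_points:
  fixes a b :: "'a::real_inner"
  obtains r :: "'a \<Rightarrow> 'a" where "\<And>x y. dist (r x) (r y) = dist x y" "r a = b"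
    "\<And>c. dist c a = dist c b \<Longrightarrow> r c = c"
proof (cases "a = b")
  case True
  then show ?thesis using that[of id] by simp
next
  case False
  define v where "v = a - b"
  define k where "k = v \<bullet> v"
  have k: "k > 0" using False by (simp add: k_def v_def)
  define r where "r x = x - ((2 * (x \<bullet> v) - (a + b) \<bullet> v) / k) *\<^sub>R v" for x
  show ?thesis
  proof (rule that[of r])
    fix x y :: 'a
    define d where "d = x - y"
    have c: "2 * (d \<bullet> v) / k = (2 * (x \<bullet> v) - (a + b) \<bullet> v) / k - (2 * (y \<bullet> v) - (a + b) \<bullet> v) / k"
      by (simp add: d_def inner_diff_left flip: diff_divide_distrib)
    have "r x - r y = d - (2 * (d \<bullet> v) / k) *\<^sub>R v"
      unfolding c scaleR_diff_left by (simp add: r_def d_def)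
    also have "norm \<dots> ^ 2 = norm d ^ 2"
      unfolding power2_norm_eq_inner using k
      by (simp add: inner_diff inner_commute k_def[symmetric] field_simps power2_eq_square)
    finally show "dist (r x) (r y) = dist x y"
      by (simp add: dist_norm d_def power2_eq_iff_nonneg)
  next
    have "2 * (a \<bullet> v) - (a + b) \<bullet> v = k"
      by (simp add: k_def v_def algebra_simps inner_commute)
    then show "r a = b" using k by (simp add: r_def v_def)
  next
    fix c assume "dist c a = dist c b"
    then have "(c - a) \<bullet> (c - a) = (c - b) \<bullet> (c - b)"
      by (simp add: dist_norm flip: power2_norm_eq_inner)
    then have "2 * (c \<bullet> v) - (a + b) \<bullet> v = 0"
      by (simp add: v_def algebra_simps inner_commute)
    then show "r c = c" by (simp add: r_def)
  qed
qed

text \<open>Points are added one at a time. If \<open>f\<close> already matches the first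
  \<open>N\<close> points, composing it with the reflection that moves \<open>f (p N)\<close> to
  \<open>q N\<close> keeps these matches, because each earlier \<open>q i\<close> is equidistant
  from the two.\<close>

lemma congruent_if_dist_eq:
  fixes p q :: "nat \<Rightarrow> 'a::real_inner"
  assumes "\<And>i j. i < N \<Longrightarrow> j < N \<Longrightarrow> dist (p i) (p j) = dist (q i) (q j)"
  shows "\<exists>f::'a \<Rightarrow> 'a. (\<forall>x y. dist (f x) (f y) = dist x y) \<and> (\<forall>i<N. f (p i) = q i)"
  using assms
proof (induction N)
  case 0
  show ?case by (rule exI[of _ id]) simp
next
  case (Suc N)
  then obtain f where f: "\<And>x y. dist (f x) (f y) = dist x y" "\<And>i. i < N \<Longrightarrow> f (p i) = q i"
    by (metis less_SucI)
  obtain r where r: "\<And>x y. dist (r x) (r y) = dist x y" "r (f (p N)) = q N"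
    "\<And>c. dist c (f (p N)) = dist c (q N) \<Longrightarrow> r c = c"
    using reflection_swapping_points[of "f (p N)" "q N"] by metis
  have "r (f (p i)) = q i" if "i < Suc N" for i
  proof (cases "i = N")
    case False
    then have "i < N" using that by simp
    then show ?thesis
      using f(1)[of "p i" "p N"] Suc.prems[of i N] by (simp add: f(2) r(3))
  qed (simp add: r)
  then show ?case using f(1) r(1) by (intro exI[of _ "r \<circ> f"]) simp
qed

section \<open>Gaussian integrals\<close>

text \<open>Left unnormalized, since only comparisons up to a positive factor matter.\<close>

definition gauss :: "'v::euclidean_space \<Rightarrow> real" where
  "gauss z = exp (- (norm z)\<^sup>2 / 2)"

lemma gauss_pos [simp]: "0 < gauss z" "0 \<le> gauss z"
  by (simp_all add: gauss_def)

lemma gauss_measurable [measurable]: "gauss \<in> borel_measurable borel"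
  unfolding gauss_def by measurable

lemma gauss_Pair: "gauss (x, y) = gauss x * gauss y"
  by (simp add: gauss_def norm_Pair flip: exp_add)

text \<open>The integrand is a product over the coordinates of one-dimensional Gaussians of variance
  2, up to a constant. Its exponent is half that of \<open>gauss\<close>, which leaves room to
  dominate \<open>gauss\<close> times a factor of linear growth.\<close>

lemma integrable_exp_minus_norm_square:
  "integrable lborel (\<lambda>z::'v::euclidean_space. exp (- (norm z)\<^sup>2 / 4))"
proof (rule integrableI_nonneg)
  have "(\<integral>\<^sup>+x. ennreal (exp (- x\<^sup>2 / 4)) \<partial>lborel) < \<infinity>"
  proof -
    have "integrable lborel (\<lambda>x. normal_density 0 (sqrt 2) x * sqrt (2 * pi * (sqrt 2)\<^sup>2))"
      using integrable_normal_moment[of "sqrt 2" 0 0] by simp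
    then have "integrable lborel (\<lambda>x::real. exp (- x\<^sup>2 / 4))"
      by (simp add: normal_density_def)
    then show ?thesis by (simp add: integrable_iff_bounded)
  qed
  then have "(\<Prod>b\<in>(Basis::'v set). \<integral>\<^sup>+x. ennreal (exp (- x\<^sup>2 / 4)) \<partial>lborel) < \<infinity>"
    by (simp add: power_less_top_ennreal)
  moreover have "(\<integral>\<^sup>+z. (\<Prod>b\<in>(Basis::'v set). ennreal (exp (- (z \<bullet> b)\<^sup>2 / 4))) \<partial>lborel)
      = (\<Prod>b\<in>(Basis::'v set). \<integral>\<^sup>+x. ennreal (exp (- x\<^sup>2 / 4)) \<partial>lborel)"
    by (rule nn_integral_lborel_prod) auto
  moreover have "(\<Prod>b\<in>(Basis::'v set). ennreal (exp (- (z \<bullet> b)\<^sup>2 / 4))) = ennreal (exp (- (norm z)\<^sup>2 / 4))" for z :: 'v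
    unfolding power2_norm_eq_inner
    by (simp add: prod_ennreal exp_sum[symmetric] euclidean_inner[of z z]
        sum_negf sum_divide_distrib[symmetric] power2_eq_square)
  ultimately show "(\<integral>\<^sup>+z. ennreal (exp (- (norm (z::'v))\<^sup>2 / 4)) \<partial>lborel) < \<infinity>" by simp
qed auto

text \<open>One half of the Gaussian exponent absorbs the linear growth, through
  \<open>r * exp (- r\<^sup>2 / 4) \<le> 2\<close>, and the other half is integrable.\<close>

lemma integrable_times_gauss:
  fixes f :: "'v::euclidean_space \<Rightarrow> real"
  assumes [measurable]: "f \<in> borel_measurable borel" and bd: "\<And>z. \<bar>f z\<bar> \<le> a + b * norm z"
  shows "integrable lborel (\<lambda>z. f z * gauss z)"
proof (rule Bochner_Integration.integrable_bound)
  show "integrable lborel (\<lambda>z::'v. (\<bar>a\<bar> + 2 * \<bar>b\<bar>) * exp (- (norm z)\<^sup>2 / 4))"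
    by (intro integrable_mult_right integrable_exp_minus_norm_square)
  show "AE z in lborel. norm (f z * gauss z) \<le> norm ((\<bar>a\<bar> + 2 * \<bar>b\<bar>) * exp (- (norm z)\<^sup>2 / 4))"
  proof (rule AE_I2)
    fix z :: 'v
    define r where "r = norm z"
    have r0: "r \<ge> 0" by (simp add: r_def)
    have split: "gauss z = exp (- r\<^sup>2 / 4) * exp (- r\<^sup>2 / 4)"
      by (simp add: gauss_def r_def flip: exp_add)
    have e1: "exp (- r\<^sup>2 / 4) \<le> 1" by simp
    have "r \<le> 2 * (1 + r\<^sup>2 / 4)"
      using zero_le_power2[of "r - 1"] by (simp add: power2_eq_square algebra_simps)
    also have "\<dots> \<le> 2 * exp (r\<^sup>2 / 4)" by (intro mult_left_mono exp_ge_add_one_self) simp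
    finally have e2: "r * exp (- r\<^sup>2 / 4) \<le> 2"
      by (simp add: exp_minus field_simps)
    have "\<bar>f z\<bar> * exp (- r\<^sup>2 / 4) \<le> (\<bar>a\<bar> + \<bar>b\<bar> * r) * exp (- r\<^sup>2 / 4)"
    proof (rule mult_right_mono)
      have "a + b * r \<le> \<bar>a\<bar> + \<bar>b\<bar> * r" using r0 by (intro add_mono mult_right_mono) auto
      then show "\<bar>f z\<bar> \<le> \<bar>a\<bar> + \<bar>b\<bar> * r" using bd[of z] by (simp add: r_def)
    qed simp
    also have "\<dots> = \<bar>a\<bar> * exp (- r\<^sup>2 / 4) + \<bar>b\<bar> * (r * exp (- r\<^sup>2 / 4))" by (simp add: algebra_simps)
    also have "\<dots> \<le> \<bar>a\<bar> * 1 + \<bar>b\<bar> * 2" using e1 e2 by (intro add_mono mult_left_mono) auto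
    finally have "\<bar>f z\<bar> * exp (- r\<^sup>2 / 4) * exp (- r\<^sup>2 / 4) \<le> (\<bar>a\<bar> * 1 + \<bar>b\<bar> * 2) * exp (- r\<^sup>2 / 4)"
      by (intro mult_right_mono) auto
    then show "norm (f z * gauss z) \<le> norm ((\<bar>a\<bar> + 2 * \<bar>b\<bar>) * exp (- (norm z)\<^sup>2 / 4))"
      by (simp add: split abs_mult r_def mult_ac)
  qed
qed measurable

lemma integrable_gauss: "integrable lborel gauss"
  using integrable_times_gauss[of "\<lambda>_. 1" 1 0] by simp

section \<open>Integration by parts for Lebesgue and Gaussian integrals\<close>

lemma
  fixes g :: "'v::euclidean_space \<Rightarrow> real"
  assumes [measurable]: "g \<in> borel_measurable borel"
  shows integral_lborel_shift: "(\<integral>x. g (x + c) \<partial>lborel) = integral\<^sup>L lborel g"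
    and integrable_lborel_shift: "integrable lborel g \<Longrightarrow> integrable lborel (\<lambda>x. g (x + c))"
proof -
  show "(\<integral>x. g (x + c) \<partial>lborel) = integral\<^sup>L lborel g"
    by (subst lborel_distr_plus[of c, symmetric], subst integral_distr) (simp_all add: add.commute)
  show "integrable lborel (\<lambda>x. g (x + c))" if "integrable lborel g"
    using that by (subst (asm) lborel_distr_plus[of c, symmetric], subst (asm) integrable_distr_eq) (simp_all add: add.commute)
qed

text \<open>The translates \<open>\<integral> H (x + t v) dx\<close> do not depend on \<open>t\<close>; integrating the
  derivative over \<open>t \<in> [0,1]\<close> first avoids differentiating under the integral sign.\<close>
lemma integral_directional_derivative:
  fixes H H' :: "'v::euclidean_space \<Rightarrow> real"
  assumes deriv: "\<And>z t. ((\<lambda>s. H (z + s *\<^sub>R v)) has_real_derivative H' (z + t *\<^sub>R v)) (at t)"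
    and cont: "continuous_on UNIV H'"
    and int: "integrable lborel H" "integrable lborel H'"
  shows "integral\<^sup>L lborel H' = 0"
proof -
  have [measurable]: "H' \<in> borel_measurable borel" using cont by (rule borel_measurable_continuous_onI)
  have Hm[measurable]: "H \<in> borel_measurable borel" using int(1) by (auto dest: borel_measurable_integrable)
  let ?f = "\<lambda>(t::real) x. indicator {0..1} t * H' (x + t *\<^sub>R v)"
  have norm: "(\<integral>x. norm (?f t x) \<partial>lborel) = indicator {0..1} t * (\<integral>x. \<bar>H' x\<bar> \<partial>lborel)" for t
    using integral_lborel_shift[of "\<lambda>x. \<bar>H' x\<bar>" "t *\<^sub>R v"] by (simp add: abs_mult)
  have prod: "integrable (lborel \<Otimes>\<^sub>M lborel) (case_prod ?f)"
  proof (rule lborel_pair.Fubini_integrable)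
    show "integrable lborel (\<lambda>t. \<integral>x. norm (case_prod ?f (t, x)) \<partial>lborel)"
      unfolding case_prod_conv norm by (intro integrable_mult_left) simp
    show "AE t in lborel. integrable lborel (\<lambda>x. case_prod ?f (t, x))"
      using integrable_lborel_shift[OF _ int(2)] by auto
  qed measurable
  have fub: "(\<integral>x. (\<integral>t. ?f t x \<partial>lborel) \<partial>lborel) = (\<integral>t. (\<integral>x. ?f t x \<partial>lborel) \<partial>lborel)"
    using lborel_pair.Fubini_integral[OF prod] by simp
  have inner1: "(\<integral>t. ?f t x \<partial>lborel) = H (x + v) - H x" for x
  proof -
    have "(\<integral>t. H' (x + t *\<^sub>R v) * indicator {0..1} t \<partial>lborel) = H (x + 1 *\<^sub>R v) - H (x + 0 *\<^sub>R v)"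
    proof (rule integral_FTC_Icc_real[OF _ deriv])
      have "continuous_on UNIV (\<lambda>t. H' (x + t *\<^sub>R v))"
        by (rule continuous_on_compose2[OF cont]) (auto intro!: continuous_intros)
      then show "isCont (\<lambda>t. H' (x + t *\<^sub>R v)) t" for t
        by (simp add: continuous_on_eq_continuous_at)
    qed auto
    then show ?thesis by (simp add: mult.commute)
  qed
  have zero: "(\<integral>x. H (x + v) - H x \<partial>lborel) = 0"
    using int(1) by (simp add: integral_lborel_shift integrable_lborel_shift)
  have inner2: "(\<integral>x. ?f t x \<partial>lborel) = indicator {0..1} t * integral\<^sup>L lborel H'" for t
    using integral_lborel_shift[of H' "t *\<^sub>R v"] by simp
  show ?thesis using fub unfolding inner1 inner2 zero by simp
qed

text \<open>The derivative of \<open>gauss\<close> along \<open>v\<close> is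
  \<open>- (v \<bullet> z) * gauss z\<close>, so the difference of the two integrands is the
  derivative of \<open>f z * gauss z\<close> along \<open>v\<close>, whose integral
  vanishes.\<close>

lemma gauss_integration_by_parts:
  fixes f f' :: "'v::euclidean_space \<Rightarrow> real"
  assumes deriv: "\<And>z t. ((\<lambda>s. f (z + s *\<^sub>R v)) has_real_derivative f' (z + t *\<^sub>R v)) (at t)"
    and cont: "continuous_on UNIV f" "continuous_on UNIV f'"
    and bd: "\<And>z. \<bar>f z\<bar> \<le> C" "\<And>z. \<bar>f' z\<bar> \<le> C'"
  shows "(\<integral>z. f z * (v \<bullet> z) * gauss z \<partial>lborel) = (\<integral>z. f' z * gauss z \<partial>lborel)"
proof -
  have [measurable]: "f \<in> borel_measurable borel" "f' \<in> borel_measurable borel"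
    using cont by (auto intro: borel_measurable_continuous_onI)
  have gd: "((\<lambda>s. gauss (z + s *\<^sub>R v)) has_real_derivative - (v \<bullet> (z + t *\<^sub>R v)) * gauss (z + t *\<^sub>R v)) (at t)"
    for z t
  proof -
    have "gauss (z + s *\<^sub>R v) = exp (- (z \<bullet> z + 2 * s * (v \<bullet> z) + s\<^sup>2 * (v \<bullet> v)) / 2)" for s
      unfolding gauss_def power2_norm_eq_inner
      by (simp add: inner_add inner_commute algebra_simps power2_eq_square)
    moreover have "((\<lambda>s. exp (- (z \<bullet> z + 2 * s * (v \<bullet> z) + s\<^sup>2 * (v \<bullet> v)) / 2)) has_real_derivative
        - (v \<bullet> (z + t *\<^sub>R v)) * exp (- (z \<bullet> z + 2 * t * (v \<bullet> z) + t\<^sup>2 * (v \<bullet> v)) / 2)) (at t)"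
      by (auto intro!: derivative_eq_intros simp: inner_add field_simps)
    ultimately show ?thesis by simp
  qed
  have int1: "integrable lborel (\<lambda>z. f z * gauss z)"
    using bd(1) by (intro integrable_times_gauss[of _ C 0]) auto
  have int2: "integrable lborel (\<lambda>z. f' z * gauss z)"
    using bd(2) by (intro integrable_times_gauss[of _ C' 0]) auto
  have int3: "integrable lborel (\<lambda>z. f z * (v \<bullet> z) * gauss z)"
  proof (rule integrable_times_gauss[of _ 0 "C * norm v"])
    have "C \<ge> 0" using bd(1)[of 0] by linarith
    then show "\<bar>f z * (v \<bullet> z)\<bar> \<le> 0 + C * norm v * norm z" for z
      using mult_mono[OF bd(1)[of z] Cauchy_Schwarz_ineq2[of v z]] by (simp add: abs_mult mult.assoc)
  qed measurable
  have "(\<integral>z. f' z * gauss z - f z * (v \<bullet> z) * gauss z \<partial>lborel) = 0"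
  proof (rule integral_directional_derivative[where H = "\<lambda>z. f z * gauss z" and v = v])
    show "((\<lambda>s. f (z + s *\<^sub>R v) * gauss (z + s *\<^sub>R v)) has_real_derivative
      f' (z + t *\<^sub>R v) * gauss (z + t *\<^sub>R v) - f (z + t *\<^sub>R v) * (v \<bullet> (z + t *\<^sub>R v)) * gauss (z + t *\<^sub>R v)) (at t)" for z t
      by (auto intro!: derivative_eq_intros deriv gd simp: algebra_simps)
    show "continuous_on UNIV (\<lambda>z. f' z * gauss z - f z * (v \<bullet> z) * gauss z)"
      unfolding gauss_def by (intro continuous_intros cont) auto
  qed (use int1 int2 int3 in auto)
  then show ?thesis using int2 int3 by simp
qed

section \<open>Volume of slabs in balls\<close>

lemma measure_lborel_shift:
  fixes S :: "'v::euclidean_space set"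
  assumes [measurable]: "S \<in> sets borel"
  shows "measure lborel ((+) c -` S) = measure lborel S"
proof -
  have "measure lborel S = measure (distr lborel borel ((+) c)) S" by (simp add: lborel_distr_plus)
  also have "\<dots> = measure lborel ((+) c -` S)" by (subst measure_distr) auto
  finally show ?thesis ..
qed

text \<open>Finitely many translates of the slab, about \<open>1 / \<epsilon>\<close> of them, cover the concentric ball of a
  quarter of the radius.\<close>
lemma measure_ball_slab_ge:
  assumes "0 < r" "0 < A"
  obtains c where "0 < c" "\<And>(z0::'v::euclidean_space) v \<epsilon>. norm v \<le> A \<Longrightarrow> v \<bullet> z0 = 0 \<Longrightarrow> 0 < \<epsilon> \<Longrightarrow> \<epsilon> \<le> 1 \<Longrightarrow>
    c * \<epsilon> \<le> measure lborel (ball z0 r \<inter> {z. \<bar>v \<bullet> z\<bar> \<le> \<epsilon>})"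
proof -
  \<comment> \<open>\<open>c1 * \<epsilon>\<close> will be the spacing of the translates: the bound
    \<open>1 / A\<close> keeps a layer of that thickness inside the slab, and the bound
    \<open>r / 2\<close> keeps the moved points inside the ball.\<close>
  define c1 where "c1 = min (1 / A) (r / 2)"
  define B where "B = measure lborel (ball (0::'v) (r / 4))"
  have B: "B > 0" unfolding B_def using content_ball_pos[of "r / 4" "0::'v"] assms by simp
  have c1: "c1 > 0" "A * c1 \<le> 1" "c1 \<le> r / 2" using assms by (auto simp: c1_def min_def field_simps)
  show thesis
  proof (rule that[of "B * c1 / (4 * r)"])
    show "0 < B * c1 / (4 * r)" using B c1 assms by simp
    fix z0 v :: 'v and \<epsilon> :: real
    assume v: "norm v \<le> A" "v \<bullet> z0 = 0" and \<epsilon>: "0 < \<epsilon>" "\<epsilon> \<le> 1"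
    obtain e :: 'v where e: "norm e = 1" "v = norm v *\<^sub>R e"
    proof (cases "v = 0")
      case True
      then show ?thesis using that[of "SOME b. b \<in> Basis"] by (simp add: SOME_Basis norm_Basis)
    next
      case False
      then show ?thesis using that[of "v /\<^sub>R norm v"] by simp
    qed
    define \<delta> where "\<delta> = c1 * \<epsilon>"
    have \<delta>: "0 < \<delta>" "\<delta> \<le> r / 2" "A * \<delta> \<le> \<epsilon>"
    proof -
      show "0 < \<delta>" using c1 \<epsilon> by (simp add: \<delta>_def)
      have "c1 * \<epsilon> \<le> (r / 2) * 1" using c1 \<epsilon> assms by (intro mult_mono) auto
      then show "\<delta> \<le> r / 2" by (simp add: \<delta>_def)
      have "(A * c1) * \<epsilon> \<le> 1 * \<epsilon>" using c1 \<epsilon> by (intro mult_right_mono) auto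
      then show "A * \<delta> \<le> \<epsilon>" by (simp add: \<delta>_def)
    qed
    define S where "S = ball z0 r \<inter> {z. \<bar>v \<bullet> z\<bar> \<le> \<epsilon>}"
    have Sm [measurable]: "S \<in> sets borel" unfolding S_def by measurable
    define K where "K = \<lceil>r / \<delta>\<rceil>"
    have "0 < r / \<delta>" using assms \<delta>(1) by simp
    then have K: "r / \<delta> \<le> of_int K" "of_int K < r / \<delta> + 1" "0 \<le> K"
      unfolding K_def by linarith+
    \<comment> \<open>Moving a point of the small ball along \<open>e\<close> by the multiple of
      \<open>\<delta>\<close> just below its signed height \<open>\<tau>\<close> over
      \<open>z0\<close> leaves a height of at most \<open>\<delta>\<close>. The shift is at most
      \<open>\<delta> + r / 4\<close>, hence at most \<open>3 * r / 4\<close>, so the moved point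
      stays in the large ball.\<close>
    have sub: "ball z0 (r / 4) \<subseteq> (\<Union>k\<in>{-K..K}. (+) ((- of_int k * \<delta>) *\<^sub>R e) -` S)"
    proof
      fix z assume z: "z \<in> ball z0 (r / 4)"
      define \<tau> where "\<tau> = e \<bullet> (z - z0)"
      have \<tau>: "\<bar>\<tau>\<bar> < r / 4"
        using Cauchy_Schwarz_ineq2[of e "z - z0"] z e by (simp add: \<tau>_def dist_norm norm_minus_commute)
      define k where "k = \<lfloor>\<tau> / \<delta>\<rfloor>"
      have k: "\<bar>\<tau> - of_int k * \<delta>\<bar> \<le> \<delta>"
      proof -
        have "of_int k \<le> \<tau> / \<delta>" "\<tau> / \<delta> < of_int k + 1" unfolding k_def by linarith+
        then have "of_int k * \<delta> \<le> \<tau>" "\<tau> < of_int k * \<delta> + \<delta>" using \<delta>(1) by (auto simp: field_simps)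
        then show ?thesis by linarith
      qed
      have kd: "\<bar>of_int k * \<delta>\<bar> \<le> 3 * r / 4" using k \<tau> \<delta>(2) by linarith
      have "\<bar>of_int k\<bar> \<le> r / \<delta>"
        using kd \<delta>(1) assms by (simp add: abs_mult field_simps)
      then have kK: "k \<in> {-K..K}" using K(1) by (auto simp: abs_le_iff)
      define y where "y = (- of_int k * \<delta>) *\<^sub>R e + z"
      have "norm (y - z0) \<le> norm (z - z0) + \<bar>of_int k * \<delta>\<bar>"
        using norm_triangle_ineq[of "z - z0" "(- of_int k * \<delta>) *\<^sub>R e"] e by (simp add: y_def algebra_simps)
      also have "\<dots> < r" using z kd by (simp add: dist_norm norm_minus_commute)
      finally have "y \<in> ball z0 r" by (simp add: dist_norm norm_minus_commute)
      moreover have "\<bar>v \<bullet> y\<bar> \<le> \<epsilon>"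
      proof -
        have "v \<bullet> y = v \<bullet> (z - z0) - of_int k * \<delta> * (v \<bullet> e)"
          using v(2) by (simp add: y_def inner_add inner_diff)
        also have "v \<bullet> (z - z0) = norm v * \<tau>" by (subst e(2)) (simp add: \<tau>_def)
        also have "v \<bullet> e = norm v"
          using e by (metis inner_scaleR_left mult.right_neutral norm_eq_1)
        finally have "v \<bullet> y = norm v * (\<tau> - of_int k * \<delta>)" by (simp add: algebra_simps)
        then have "\<bar>v \<bullet> y\<bar> \<le> A * \<delta>"
          using k v(1) assms by (auto simp: abs_mult intro!: mult_mono)
        then show ?thesis using \<delta>(3) by linarith
      qed
      ultimately have "y \<in> S" by (simp add: S_def)
      then show "z \<in> (\<Union>k\<in>{-K..K}. (+) ((- of_int k * \<delta>) *\<^sub>R e) -` S)"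
        using kK unfolding y_def by blast
    qed
    have fin: "emeasure lborel ((+) x -` S) \<noteq> \<infinity>" for x
    proof -
      have "(+) x -` S \<subseteq> ball (z0 - x) r" by (auto simp: S_def dist_norm algebra_simps)
      then show ?thesis
        using emeasure_mono[of "(+) x -` S" "ball (z0 - x) r" lborel] emeasure_lborel_ball_finite[of "z0 - x" r]
        by (auto simp: top_unique less_top)
    qed
    have meas: "(+) x -` S \<in> sets lborel" for x
      using measurable_sets[of "(+) x" lborel lborel S] Sm by simp
    have "B = measure lborel (ball z0 (r / 4))"
      using assms by (simp add: B_def content_ball)
    also have "\<dots> \<le> measure lborel (\<Union>k\<in>{-K..K}. (+) ((- of_int k * \<delta>) *\<^sub>R e) -` S)"
    proof (rule measure_mono_fmeasurable[OF sub])
      show "(\<Union>k\<in>{-K..K}. (+) ((- of_int k * \<delta>) *\<^sub>R e) -` S) \<in> fmeasurable lborel"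
        using meas fin by (intro fmeasurable.finite_UN) (auto simp: fmeasurable_def less_top)
    qed simp
    also have "\<dots> \<le> (\<Sum>k\<in>{-K..K}. measure lborel ((+) ((- of_int k * \<delta>) *\<^sub>R e) -` S))"
      using meas fin by (intro measure_subadditive_finite) auto
    also have "\<dots> = real (card {-K..K}) * measure lborel S"
      by (simp add: measure_lborel_shift)
    \<comment> \<open>There are \<open>2 * K + 1\<close> translates; since
      \<open>\<delta> \<le> r / 2\<close>, doubling \<open>2 * r / \<delta>\<close> absorbs the
      additive constants from rounding.\<close>
    also have "\<dots> \<le> (4 * r / \<delta>) * measure lborel S"
    proof (rule mult_right_mono)
      have "real (card {-K..K}) = 2 * of_int K + 1" using K(3) by simp
      also have "\<dots> \<le> 2 * (r / \<delta>) + 3" using K(2) by linarith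
      also have "3 \<le> 2 * (r / \<delta>)" using \<delta> by (simp add: field_simps)
      finally show "real (card {-K..K}) \<le> 4 * r / \<delta>" by simp
    qed simp
    finally have "B * \<delta> \<le> 4 * r * measure lborel S" using \<delta>(1) by (simp add: field_simps)
    then show "B * c1 / (4 * r) * \<epsilon> \<le> measure lborel (ball z0 r \<inter> {z. \<bar>v \<bullet> z\<bar> \<le> \<epsilon>})"
      using assms by (simp add: \<delta>_def S_def field_simps)
  qed
qed

section \<open>Mean width as a Gaussian integral\<close>

text \<open>The cone over \<open>A\<close> is the preimage of \<open>A\<close> under the radial
  projection of the punctured unit ball, so the measure is the image of Lebesgue measure under that
  projection, times the dimension. Integrals over the sphere thus become Lebesgue integrals over the
  ball.\<close>

lemma sphere_surface_measure_eq:
  "(sphere_surface_measure :: 'a::euclidean_space measure) =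
     density (distr (restrict_space lborel (cball 0 1 - {0})) (restrict_space borel (sphere 0 1)) (\<lambda>x. x /\<^sub>R norm x))
       (\<lambda>_. ennreal (real DIM('a)))" (is "_ = ?M")
proof -
  let ?S = "sphere (0::'a) 1" and ?D = "cball (0::'a) 1 - {0}" and ?P = "\<lambda>x::'a. x /\<^sub>R norm x"
  have [measurable]: "?P \<in> restrict_space lborel ?D \<rightarrow>\<^sub>M restrict_space borel ?S"
    by (rule measurable_restrict_space3) auto
  have space: "space ?M = ?S" by (simp add: space_restrict_space)
  have sets: "sets ?M = sets (restrict_space borel ?S)" by simp
  have "measure_of ?S (sets (restrict_space borel ?S))
       (\<lambda>A. of_nat DIM('a) * emeasure lborel {t *\<^sub>R u | t u. u \<in> A \<and> 0 < t \<and> t \<le> 1}) =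
     measure_of ?S (sets (restrict_space borel ?S)) (emeasure ?M)"
  proof (rule measure_of_eq)
    show "sets (restrict_space borel ?S) \<subseteq> Pow ?S"
      using sets.sets_into_space by (fastforce simp: space_restrict_space)
    fix A assume "A \<in> sigma_sets ?S (sets (restrict_space borel ?S))"
    then have A: "A \<in> sets (restrict_space borel ?S)"
      using sets.sigma_sets_eq[of "restrict_space borel ?S"] by (simp add: space_restrict_space)
    then have AS: "A \<subseteq> ?S" using sets.sets_into_space by (fastforce simp: space_restrict_space)
    have "{t *\<^sub>R u | t u. u \<in> A \<and> 0 < t \<and> t \<le> 1} = ?P -` A \<inter> ?D"
    proof (intro equalityI subsetI)
      fix x assume "x \<in> {t *\<^sub>R u | t u. u \<in> A \<and> 0 < t \<and> t \<le> 1}"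
      then obtain t u where tu: "x = t *\<^sub>R u" "u \<in> A" "0 < t" "t \<le> 1" by blast
      have "norm u = 1" using tu AS by auto
      then show "x \<in> ?P -` A \<inter> ?D" using tu by auto
    next
      fix x assume x: "x \<in> ?P -` A \<inter> ?D"
      then have "x = norm x *\<^sub>R ?P x" "?P x \<in> A" "0 < norm x" "norm x \<le> 1" by auto
      then show "x \<in> {t *\<^sub>R u | t u. u \<in> A \<and> 0 < t \<and> t \<le> 1}" by blast
    qed
    then show "of_nat DIM('a) * emeasure lborel {t *\<^sub>R u | t u. u \<in> A \<and> 0 < t \<and> t \<le> 1} = emeasure ?M A"
      using A by (simp add: emeasure_density_const emeasure_distr emeasure_restrict_space space_restrict_space
          ennreal_of_nat_eq_real_of_nat)
  qed
  then show ?thesis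
    unfolding sphere_surface_measure_def using measure_of_of_measure[of ?M] unfolding space sets by simp
qed

lemma mean_width_eq_integral_cball:
  fixes K :: "'a::euclidean_space set"
  assumes [measurable]: "support_fun K \<in> borel_measurable borel"
  shows "mean_width K = real DIM('a) * (\<integral>x. indicator (cball 0 1 - {0}) x * support_fun K (x /\<^sub>R norm x) \<partial>lborel)"
proof -
  let ?S = "sphere (0::'a) 1" and ?D = "cball (0::'a) 1 - {0}" and ?P = "\<lambda>x::'a. x /\<^sub>R norm x"
  have [measurable]: "?P \<in> restrict_space lborel ?D \<rightarrow>\<^sub>M restrict_space borel ?S"
    by (rule measurable_restrict_space3) auto
  have [measurable]: "support_fun K \<in> borel_measurable (restrict_space borel ?S)"
    by (rule measurable_restrict_space1) measurable
  show ?thesis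
    unfolding mean_width_def sphere_surface_measure_eq
    by (subst integral_density) (auto simp: integral_distr integral_restrict_space)
qed

section \<open>Support functions of finite configurations\<close>

definition max_inner :: "(nat \<Rightarrow> 'v::euclidean_space) \<Rightarrow> nat \<Rightarrow> 'v \<Rightarrow> real" where
  "max_inner p N u = Max ((\<lambda>i. p i \<bullet> u) ` {..<N})"

lemma max_inner_measurable [measurable]: "max_inner p N \<in> borel_measurable borel"
  unfolding max_inner_def by measurable

lemma max_inner_ge: "i < N \<Longrightarrow> p i \<bullet> u \<le> max_inner p N u"
  unfolding max_inner_def by (intro Max_ge) auto

lemma max_inner_attained:
  assumes "0 < N" obtains i where "i < N" "max_inner p N u = p i \<bullet> u"
proof -
  have "max_inner p N u \<in> (\<lambda>i. p i \<bullet> u) ` {..<N}"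
    unfolding max_inner_def using assms by (intro Max_in) auto
  then show thesis using that by auto
qed

lemma max_inner_homogeneous:
  assumes "0 < N" "0 \<le> c"
  shows "max_inner p N (c *\<^sub>R u) = c * max_inner p N u"
proof -
  have "mono ((*) c)" using assms(2) by (simp add: mono_def mult_left_mono)
  from mono_Max_commute[OF this, of "(\<lambda>i. p i \<bullet> u) ` {..<N}"] show ?thesis
    using assms(1) by (auto simp: max_inner_def image_image lessThan_empty_iff)
qed

lemma abs_max_inner_le:
  assumes "0 < N" shows "\<bar>max_inner p N u\<bar> \<le> (\<Sum>i<N. norm (p i)) * norm u"
proof -
  obtain i where i: "i < N" "max_inner p N u = p i \<bullet> u" using max_inner_attained[OF assms] by metis
  have "norm (p i) \<le> (\<Sum>i<N. norm (p i))" using i by (intro member_le_sum) auto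
  then show ?thesis
    using i Cauchy_Schwarz_ineq2[of "p i" u] by (smt (verit) mult_right_mono norm_ge_zero)
qed

lemma support_fun_convex_hull:
  assumes "0 < N" shows "support_fun (convex hull (p ` {..<N})) = max_inner p N"
proof
  fix u
  show "support_fun (convex hull (p ` {..<N})) u = max_inner p N u"
    unfolding support_fun_def
  proof (rule cSup_eq_maximum)
    obtain i where i: "i < N" "max_inner p N u = p i \<bullet> u" using max_inner_attained[OF assms] by metis
    then show "max_inner p N u \<in> (\<lambda>x. x \<bullet> u) ` (convex hull (p ` {..<N}))"
      by (auto intro!: imageI hull_inc)
    have "convex hull (p ` {..<N}) \<subseteq> {x. u \<bullet> x \<le> max_inner p N u}"
      using max_inner_ge[of _ N p u] by (intro hull_minimal convex_halfspace_le) (auto simp: inner_commute)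
    then show "y \<le> max_inner p N u" if "y \<in> (\<lambda>x. x \<bullet> u) ` (convex hull (p ` {..<N}))" for y
      using that by (auto simp: inner_commute)
  qed
qed

text \<open>\<open>A\<close> agrees with the ball of radius \<open>r\<close> except possibly at the
  origin, and \<open>h 0 = 0\<close>. Substituting \<open>r *\<^sub>R x\<close> gives one factor
  \<open>r\<close> per dimension from the volume and one more from homogeneity.\<close>

lemma integral_homogeneous_cball:
  fixes h :: "'v::euclidean_space \<Rightarrow> real"
  assumes [measurable]: "h \<in> borel_measurable borel"
    and hom: "\<And>c x. 0 \<le> c \<Longrightarrow> h (c *\<^sub>R x) = c * h x"
    and A: "\<And>x. x \<noteq> 0 \<Longrightarrow> x \<in> A \<longleftrightarrow> norm x \<le> r"
  shows "(\<integral>x. h x * indicator A x \<partial>lborel)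
    = (if r > 0 then r ^ Suc DIM('v) else 0) * (\<integral>x. h x * indicator (cball 0 1) x \<partial>lborel)"
proof -
  have h0: "h 0 = 0" using hom[of 0 0] by simp
  have eq: "h x * indicator A x = h x * indicator (cball 0 r) x" for x
    using A[of x] by (cases "x = 0") (auto simp: h0 indicator_def)
  show ?thesis
  proof (cases "r > 0")
    case True
    have "(\<integral>x. h x * indicator (cball 0 r) x \<partial>lborel)
      = (\<integral>x. h x * indicator (cball 0 r) x \<partial>density (distr lborel borel (\<lambda>x. 0 + r *\<^sub>R x)) (\<lambda>_. \<bar>r\<bar>^DIM('v)))"
      using lborel_affine[of r "0::'v"] True by simp
    also have "\<dots> = (\<integral>x. r ^ DIM('v) * (h (r *\<^sub>R x) * indicator (cball 0 r) (r *\<^sub>R x)) \<partial>lborel)"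
    proof -
      have [measurable]: "(\<lambda>x. h x * indicator (cball 0 r) x) \<in> borel_measurable borel"
        by (intro borel_measurable_times borel_measurable_indicator) auto
      show ?thesis using True by (subst integral_density) (simp_all add: integral_distr)
    qed
    also have "\<dots> = (\<integral>x. r ^ Suc DIM('v) * (h x * indicator (cball 0 1) x) \<partial>lborel)"
      using True by (intro Bochner_Integration.integral_cong) (auto simp: hom indicator_def)
    finally show ?thesis using True by (simp add: eq)
  next
    case False
    have "h x * indicator (cball 0 r) x = 0" for x
    proof (cases "x = 0")
      case False
      then have "\<not> norm x \<le> r" using \<open>\<not> r > 0\<close> by (meson order_less_le_trans zero_less_norm_iff)
      then show ?thesis by simp
    qed (simp add: h0)
    then show ?thesis using False unfolding eq by (simp only:) simp
  qed
qed

text \<open>Write \<open>w x\<close> as the length of the interval from 0 to \<open>w x\<close> and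
  exchange the integrals. As \<open>h\<close> may change sign, Fubini is applied with the
  integrability of \<open>h x * w x\<close>.\<close>

lemma integral_layer_cake:
  fixes h w :: "'v::euclidean_space \<Rightarrow> real"
  assumes [measurable]: "h \<in> borel_measurable borel" "w \<in> borel_measurable borel"
    and w: "\<And>x. 0 \<le> w x" and int: "integrable lborel (\<lambda>x. h x * w x)"
  shows "(\<integral>x. h x * w x \<partial>lborel) = (\<integral>s. indicator {0<..} s * (\<integral>x. h x * indicator {x. s \<le> w x} x \<partial>lborel) \<partial>lborel)"
proof -
  let ?f = "\<lambda>x s. h x * indicator {0<..w x} s :: real"
  have i: "(\<integral>s. norm (?f x s) \<partial>lborel) = \<bar>h x\<bar> * w x" "(\<integral>s. ?f x s \<partial>lborel) = h x * w x" for x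
    using w[of x] by (simp_all add: abs_mult)
  have prod: "integrable (lborel \<Otimes>\<^sub>M lborel) (case_prod ?f)"
  proof (rule lborel_pair.Fubini_integrable)
    have "integrable lborel (\<lambda>x. \<bar>h x * w x\<bar>)" using int by simp
    then show "integrable lborel (\<lambda>x. \<integral>s. norm (case_prod ?f (x, s)) \<partial>lborel)"
      unfolding case_prod_conv i using w by (simp add: abs_mult)
    show "AE x in lborel. integrable lborel (\<lambda>s. case_prod ?f (x, s))"
    proof (rule AE_I2)
      fix x show "integrable lborel (\<lambda>s. case_prod ?f (x, s))"
        using w[of x] by (simp add: integrable_real_indicator)
    qed
    have "(\<lambda>(x, s). h x * (if 0 < s \<and> s \<le> w x then 1 else 0)) \<in> borel_measurable (lborel \<Otimes>\<^sub>M lborel)"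
      by measurable
    then show "case_prod ?f \<in> borel_measurable (lborel \<Otimes>\<^sub>M lborel)"
      by (simp add: indicator_def)
  qed
  have "(\<integral>x. h x * w x \<partial>lborel) = (\<integral>s. (\<integral>x. ?f x s \<partial>lborel) \<partial>lborel)"
    unfolding lborel_pair.Fubini_integral[OF prod] i ..
  also have "\<dots> = (\<integral>s. indicator {0<..} s * (\<integral>x. h x * indicator {x. s \<le> w x} x \<partial>lborel) \<partial>lborel)"
    by (intro Bochner_Integration.integral_cong refl) (auto simp: indicator_def)
  finally show ?thesis .
qed

text \<open>Up to the origin, the superlevel sets of \<open>w\<close> are balls or empty, and on
  each the integrals of \<open>h\<close> and of the norm carry the same power of the radius. By the
  layer cake formula the ratio of these two integrals does not depend on the radial weight
  \<open>w\<close>; the statement is cleared of denominators.\<close>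

lemma radial_integral_proportional:
  fixes h w :: "'v::euclidean_space \<Rightarrow> real"
  assumes h[measurable]: "h \<in> borel_measurable borel"
    and hom: "\<And>c x. 0 \<le> c \<Longrightarrow> h (c *\<^sub>R x) = c * h x" and bd: "\<And>x. \<bar>h x\<bar> \<le> C * norm x"
    and w[measurable]: "w \<in> borel_measurable borel" and w0: "\<And>x. 0 \<le> w x"
    and int: "integrable lborel (\<lambda>x. norm x * w x)"
    and level: "\<And>s. 0 < s \<Longrightarrow> \<exists>r. \<forall>x. x \<noteq> 0 \<longrightarrow> (s \<le> w x \<longleftrightarrow> norm x \<le> r)"
  shows "(\<integral>x. h x * w x \<partial>lborel) * (\<integral>x. norm x * indicator (cball (0::'v) 1) x \<partial>lborel)
    = (\<integral>x. h x * indicator (cball 0 1) x \<partial>lborel) * (\<integral>x. norm x * w x \<partial>lborel)"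
proof -
  let ?M = "\<integral>x. norm x * indicator (cball (0::'v) 1) x \<partial>lborel" and ?J = "\<integral>x. h x * indicator (cball 0 1) x \<partial>lborel"
  have inth: "integrable lborel (\<lambda>x. h x * w x)"
  proof (rule Bochner_Integration.integrable_bound)
    show "integrable lborel (\<lambda>x. C * (norm x * w x))" using int by simp
    show "AE x in lborel. norm (h x * w x) \<le> norm (C * (norm x * w x))"
    proof (rule AE_I2)
      fix x
      have "\<bar>h x\<bar> * w x \<le> (C * norm x) * w x" using bd w0 by (intro mult_right_mono) auto
      then show "norm (h x * w x) \<le> norm (C * (norm x * w x))"
        using w0[of x] abs_ge_self[of "C * (norm x * w x)"] by (simp add: abs_mult mult_ac)
    qed
  qed measurable
  have level_eq: "indicator {0<..} s * (\<integral>x. h x * indicator {x. s \<le> w x} x \<partial>lborel) * ?M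
     = ?J * (indicator {0<..} s * (\<integral>x. norm x * indicator {x. s \<le> w x} x \<partial>lborel))" for s :: real
  proof (cases "0 < s")
    case True
    then obtain r where r: "\<And>x. x \<noteq> 0 \<Longrightarrow> x \<in> {x. s \<le> w x} \<longleftrightarrow> norm x \<le> r" using level by blast
    have "(\<integral>x. norm x * indicator {x. s \<le> w x} x \<partial>lborel) = (if r > 0 then r ^ Suc DIM('v) else 0) * ?M"
      by (rule integral_homogeneous_cball[OF _ _ r]) auto
    moreover have "(\<integral>x. h x * indicator {x. s \<le> w x} x \<partial>lborel) = (if r > 0 then r ^ Suc DIM('v) else 0) * ?J"
      by (rule integral_homogeneous_cball[OF h hom r])
    ultimately show ?thesis by (simp only: mult_ac)
  qed simp
  have "(\<integral>x. h x * w x \<partial>lborel) * ?M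
     = (\<integral>s. indicator {0<..} s * (\<integral>x. h x * indicator {x. s \<le> w x} x \<partial>lborel) * ?M \<partial>lborel)"
    by (simp add: integral_layer_cake[OF h w w0 inth])
  also have "\<dots> = ?J * (\<integral>x. norm x * w x \<partial>lborel)"
    unfolding level_eq by (simp add: integral_layer_cake[OF _ w w0 int])
  finally show ?thesis .
qed

lemma integral_pos_if_pos_on_cball:
  fixes f :: "'v::euclidean_space \<Rightarrow> real"
  assumes "integrable lborel f" "\<And>x. 0 \<le> f x" "\<And>x. x \<noteq> 0 \<Longrightarrow> norm x \<le> 1 \<Longrightarrow> 0 < f x"
  shows "0 < integral\<^sup>L lborel f"
proof (rule ccontr)
  assume "\<not> 0 < integral\<^sup>L lborel f"
  then have "integral\<^sup>L lborel f = 0" using Bochner_Integration.integral_nonneg[of lborel f, OF assms(2)] by linarith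
  then have "AE x in lborel. f x = 0" using assms by (simp add: integral_nonneg_eq_0_iff_AE)
  then have "AE x in lborel. x \<notin> cball (0::'v) 1 - {0}"
    by eventually_elim (use assms(3) in force)
  then have "emeasure lborel (cball (0::'v) 1 - {0}) = 0"
    by (subst (asm) AE_iff_measurable[where N = "cball (0::'v) 1 - {0}"]) auto
  moreover have "emeasure lborel (cball (0::'v) 1 - {0}) = emeasure lborel (cball (0::'v) 1)"
    by (intro emeasure_Diff_null_set) auto
  ultimately have "measure lborel (cball (0::'v) 1) = 0" by (simp add: measure_def)
  then show False using content_cball_pos[of 1 "0::'v"] by simp
qed

text \<open>Two radial weights are compared through \<open>radial_integral_proportional\<close>: the
  Gaussian, and \<open>1 / norm x\<close> on the punctured unit ball. By homogeneity the second
  turns \<open>max_inner p N x\<close> into its value at the radial projection of \<open>x\<close>,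
  which is what the mean width integrates.\<close>

lemma mean_width_eq_gauss:
  obtains c where "0 < c" "\<And>(p :: nat \<Rightarrow> 'a::euclidean_space) N. 0 < N \<Longrightarrow>
    mean_width (convex hull (p ` {..<N})) = c * (\<integral>x. max_inner p N x * gauss x \<partial>lborel)"
proof -
  let ?D = "cball (0::'a) 1 - {0}"
  let ?w = "\<lambda>x::'a. indicator ?D x / norm x"
  have wm: "?w \<in> borel_measurable borel"
    by (intro borel_measurable_divide borel_measurable_indicator) auto
  define V where "V = (\<integral>x. norm x * ?w x \<partial>lborel)"
  define \<Gamma> where "\<Gamma> = (\<integral>x. norm (x::'a) * gauss x \<partial>lborel)"
  define J where "J = (\<integral>x. norm x * indicator (cball (0::'a) 1) x \<partial>lborel)"
  have emD: "emeasure lborel ?D < \<infinity>"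
    using emeasure_mono[of ?D "cball 0 1" lborel] emeasure_lborel_cball_finite[of "0::'a" 1] by (auto simp: less_top)
  have intw: "integrable lborel (\<lambda>x. norm x * ?w x)"
  proof -
    have "(\<lambda>x. norm x * ?w x) = indicator ?D" by (auto simp: indicator_def)
    then show ?thesis using emD by simp
  qed
  have intg: "integrable lborel (\<lambda>x::'a. norm x * gauss x)"
    by (rule integrable_times_gauss[of _ 0 1]) auto
  have intJ: "integrable lborel (\<lambda>x. norm x * indicator (cball (0::'a) 1) x)"
  proof (rule Bochner_Integration.integrable_bound)
    show "integrable lborel (indicator (cball (0::'a) 1) :: 'a \<Rightarrow> real)"
      using emeasure_lborel_cball_finite[of "0::'a" 1] by (intro integrable_real_indicator) (auto simp: less_top)
  qed (auto simp: indicator_def)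
  have pos: "V > 0" "\<Gamma> > 0" "J > 0"
    unfolding V_def \<Gamma>_def J_def
    by (rule integral_pos_if_pos_on_cball[OF intw] integral_pos_if_pos_on_cball[OF intg]
        integral_pos_if_pos_on_cball[OF intJ]; simp add: indicator_def)+
  show thesis
  proof (rule that[of "real DIM('a) * (V / \<Gamma>)"])
    show "0 < real DIM('a) * (V / \<Gamma>)" using pos by simp
    fix p :: "nat \<Rightarrow> 'a" and N :: nat assume N: "0 < N"
    let ?h = "max_inner p N"
    \<comment> \<open>Inside the ball \<open>1 / norm x\<close> is at least \<open>s\<close> up to
      radius \<open>1 / s\<close>, and beyond radius 1 the weight is 0.\<close>
    have lw: "\<exists>r. \<forall>x. x \<noteq> 0 \<longrightarrow> (s \<le> ?w x \<longleftrightarrow> norm x \<le> r)" if "0 < s" for s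
      using that by (intro exI[of _ "min 1 (1 / s)"]) (auto simp: indicator_def field_simps mult_le_0_iff)
    \<comment> \<open>For \<open>s > 1\<close> the level set is empty, which is encoded by the
      radius \<open>-1\<close>.\<close>
    have lg: "\<exists>r. \<forall>x::'a. x \<noteq> 0 \<longrightarrow> (s \<le> gauss x \<longleftrightarrow> norm x \<le> r)" if "0 < s" for s
    proof (cases "s \<le> 1")
      case True
      have "s \<le> gauss x \<longleftrightarrow> norm x \<le> sqrt (- 2 * ln s)" for x :: 'a
      proof -
        have "s \<le> gauss x \<longleftrightarrow> (norm x)\<^sup>2 \<le> - 2 * ln s"
        proof -
          have "s \<le> gauss x \<longleftrightarrow> ln s \<le> - (norm x)\<^sup>2 / 2"
            using that ln_le_cancel_iff[of s "gauss x"] by (simp add: gauss_def)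
          then show ?thesis by argo
        qed
        also have "\<dots> \<longleftrightarrow> norm x \<le> sqrt (- 2 * ln s)"
          using real_le_rsqrt real_sqrt_le_iff[of "(norm x)\<^sup>2"] by auto
        finally show ?thesis .
      qed
      then show ?thesis by blast
    next
      case False
      have "\<not> s \<le> gauss x" for x :: 'a
        using False by (smt (verit, ccfv_SIG) gauss_def exp_le_one_iff divide_nonpos_pos zero_le_power2)
      moreover have "\<not> norm x \<le> -1" for x :: 'a by (smt (verit) norm_ge_zero)
      ultimately show ?thesis by blast
    qed
    note base = max_inner_measurable max_inner_homogeneous[OF N] abs_max_inner_le[OF N]
    have 1: "(\<integral>x. ?h x * ?w x \<partial>lborel) * J = (\<integral>x. ?h x * indicator (cball 0 1) x \<partial>lborel) * V"
      unfolding J_def V_def by (rule radial_integral_proportional[OF base wm _ intw lw]) auto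
    have 2: "(\<integral>x. ?h x * gauss x \<partial>lborel) * J = (\<integral>x. ?h x * indicator (cball 0 1) x \<partial>lborel) * \<Gamma>"
      unfolding J_def \<Gamma>_def by (rule radial_integral_proportional[OF base _ _ intg lg]) auto
    have "((\<integral>x. ?h x * ?w x \<partial>lborel) * \<Gamma>) * J = ((\<integral>x. ?h x * gauss x \<partial>lborel) * V) * J"
      using 1 2 by (metis mult.assoc mult.commute)
    then have "(\<integral>x. ?h x * ?w x \<partial>lborel) = V / \<Gamma> * (\<integral>x. ?h x * gauss x \<partial>lborel)"
      using pos by (simp add: field_simps)
    moreover have "indicator ?D x * ?h (x /\<^sub>R norm x) = ?h x * ?w x" for x
      using max_inner_homogeneous[OF N, of "inverse (norm x)" p x] by (simp add: field_simps)
    ultimately show "mean_width (convex hull (p ` {..<N})) = real DIM('a) * (V / \<Gamma>) * (\<integral>x. ?h x * gauss x \<partial>lborel)"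
      using mean_width_eq_integral_cball[of "convex hull (p ` {..<N})"] max_inner_measurable[of p N]
      by (simp add: support_fun_convex_hull[OF N] mult.assoc)
  qed
qed

section \<open>Softmax and the interpolation formula\<close>

definition softmax :: "real \<Rightarrow> nat \<Rightarrow> (nat \<Rightarrow> real) \<Rightarrow> nat \<Rightarrow> real" where
  "softmax \<beta> N y i = exp (\<beta> * y i) / (\<Sum>j<N. exp (\<beta> * y j))"

definition log_sum_exp :: "real \<Rightarrow> nat \<Rightarrow> (nat \<Rightarrow> real) \<Rightarrow> real" where
  "log_sum_exp \<beta> N y = ln (\<Sum>j<N. exp (\<beta> * y j)) / \<beta>"

lemma sum_exp_pos: "0 < (N::nat) \<Longrightarrow> 0 < (\<Sum>j<N. exp (\<beta> * y j :: real))"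
  by (rule sum_pos) auto

lemma softmax_nonneg: "0 \<le> softmax \<beta> N y i"
  by (simp add: softmax_def sum_nonneg)

lemma softmax_sum: "0 < N \<Longrightarrow> (\<Sum>i<N. softmax \<beta> N y i) = 1"
  using sum_exp_pos[of N \<beta> y] by (simp add: softmax_def flip: sum_divide_distrib)

lemma softmax_le_1: "i < N \<Longrightarrow> softmax \<beta> N y i \<le> 1"
  using softmax_sum[of N \<beta> y] member_le_sum[of i "{..<N}" "softmax \<beta> N y"] softmax_nonneg by auto

lemma softmax_measurable [measurable]:
  assumes [measurable]: "\<And>j. y j \<in> borel_measurable M"
  shows "(\<lambda>x. softmax \<beta> N (\<lambda>j. y j x) i) \<in> borel_measurable M"
  unfolding softmax_def by measurable

lemma log_sum_exp_measurable [measurable]: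
  assumes [measurable]: "\<And>j. y j \<in> borel_measurable M"
  shows "(\<lambda>x. log_sum_exp \<beta> N (\<lambda>j. y j x)) \<in> borel_measurable M"
  unfolding log_sum_exp_def by measurable

lemma softmax_continuous_on:
  assumes "0 < N" "\<And>j. continuous_on S (y j)"
  shows "continuous_on S (\<lambda>x. softmax \<beta> N (\<lambda>j. y j x) i)"
  unfolding softmax_def using assms sum_exp_pos[OF assms(1)]
  by (intro continuous_intros) (auto simp: less_imp_neq[THEN not_sym])

text \<open>The largest term alone bounds the sum of exponentials from below, and \<open>N\<close>
  copies of it bound the sum from above. The error does not depend on \<open>z\<close>.\<close>

lemma log_sum_exp_bounds:
  assumes N: "0 < N" and \<beta>: "0 < \<beta>"
  shows "max_inner a N z \<le> log_sum_exp \<beta> N (\<lambda>i. a i \<bullet> z)"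
    and "log_sum_exp \<beta> N (\<lambda>i. a i \<bullet> z) \<le> max_inner a N z + ln N / \<beta>"
proof -
  let ?s = "\<Sum>j<N. exp (\<beta> * (a j \<bullet> z))"
  obtain i where i: "i < N" "max_inner a N z = a i \<bullet> z" using max_inner_attained[OF N] by metis
  have "exp (\<beta> * (a i \<bullet> z)) \<le> ?s" using i by (intro member_le_sum) auto
  then have "\<beta> * (a i \<bullet> z) \<le> ln ?s" using sum_exp_pos[OF N, of \<beta>] by (simp add: ln_ge_iff)
  then show "max_inner a N z \<le> log_sum_exp \<beta> N (\<lambda>i. a i \<bullet> z)"
    using \<beta> i by (simp add: log_sum_exp_def field_simps)
  have "?s \<le> (\<Sum>j<N. exp (\<beta> * max_inner a N z))"
    using \<beta> max_inner_ge[of _ N a z] by (intro sum_mono) auto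
  then have "ln ?s \<le> ln (real N * exp (\<beta> * max_inner a N z))"
    using sum_exp_pos[OF N, of \<beta>] N by (intro ln_mono) auto
  also have "\<dots> = ln N + \<beta> * max_inner a N z" using N by (simp add: ln_mult)
  finally show "log_sum_exp \<beta> N (\<lambda>i. a i \<bullet> z) \<le> max_inner a N z + ln N / \<beta>"
    using \<beta> by (simp add: log_sum_exp_def field_simps)
qed

lemma log_sum_exp_has_derivative:
  assumes N: "0 < N" and \<beta>: "0 < \<beta>" and y: "\<And>j. ((\<lambda>t. y j t) has_real_derivative y' j) (at t)"
  shows "((\<lambda>t. log_sum_exp \<beta> N (\<lambda>j. y j t)) has_real_derivative
    (\<Sum>i<N. softmax \<beta> N (\<lambda>j. y j t) i * y' i)) (at t)"
proof -
  have "((\<lambda>t. ln (\<Sum>j<N. exp (\<beta> * y j t)) / \<beta>) has_real_derivative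
     ((\<Sum>i<N. exp (\<beta> * y i t) * (\<beta> * y' i)) / (\<Sum>j<N. exp (\<beta> * y j t))) / \<beta>) (at t)"
    using \<beta> sum_exp_pos[OF N, of \<beta> "\<lambda>j. y j t"] by (auto intro!: derivative_eq_intros y simp: mult_ac)
  also have "((\<Sum>i<N. exp (\<beta> * y i t) * (\<beta> * y' i)) / (\<Sum>j<N. exp (\<beta> * y j t))) / \<beta>
     = (\<Sum>i<N. softmax \<beta> N (\<lambda>j. y j t) i * y' i)"
    unfolding sum_divide_distrib softmax_def using \<beta> by (intro sum.cong) (auto simp: field_simps)
  finally show ?thesis by (simp add: log_sum_exp_def)
qed

lemma softmax_has_derivative:
  assumes N: "0 < N" and y: "\<And>j. ((\<lambda>t. y j t) has_real_derivative y' j) (at t)"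
  shows "((\<lambda>t. softmax \<beta> N (\<lambda>j. y j t) i) has_real_derivative
    \<beta> * softmax \<beta> N (\<lambda>j. y j t) i * (y' i - (\<Sum>j<N. softmax \<beta> N (\<lambda>j. y j t) j * y' j))) (at t)"
proof -
  define s where "s = (\<Sum>j<N. exp (\<beta> * y j t))"
  have s: "s > 0" using sum_exp_pos[OF N] by (simp add: s_def)
  have "((\<lambda>t. exp (\<beta> * y i t) / (\<Sum>j<N. exp (\<beta> * y j t))) has_real_derivative
     ((exp (\<beta> * y i t) * (\<beta> * y' i)) * s - exp (\<beta> * y i t) * (\<Sum>j<N. exp (\<beta> * y j t) * (\<beta> * y' j))) / (s * s)) (at t)"
    using s unfolding s_def by (auto intro!: derivative_eq_intros y simp: mult_ac)
  also have "((exp (\<beta> * y i t) * (\<beta> * y' i)) * s - exp (\<beta> * y i t) * (\<Sum>j<N. exp (\<beta> * y j t) * (\<beta> * y' j))) / (s * s)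
    = \<beta> * (exp (\<beta> * y i t) / s) * (y' i - (\<Sum>j<N. exp (\<beta> * y j t) * y' j) / s)"
    using s by (simp add: field_simps sum_distrib_left)
  also have "(\<Sum>j<N. exp (\<beta> * y j t) * y' j) / s = (\<Sum>j<N. softmax \<beta> N (\<lambda>j. y j t) j * y' j)"
    by (simp add: softmax_def s_def sum_divide_distrib)
  finally show ?thesis by (simp add: softmax_def s_def)
qed

text \<open>Gaussian integration by parts applied to a single weight. All weights lie in [0, 1], so
  the weight and its derivative along \<open>v\<close> are bounded as required.\<close>

lemma gauss_softmax_integration_by_parts:
  fixes a :: "nat \<Rightarrow> 'v::euclidean_space" and \<beta> :: real
  assumes N: "0 < N" and i: "i < N"
  defines "w \<equiv> \<lambda>z. softmax \<beta> N (\<lambda>j. a j \<bullet> z)"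
  shows "(\<integral>z. w z i * (v \<bullet> z) * gauss z \<partial>lborel)
    = (\<integral>z. \<beta> * w z i * (a i \<bullet> v - (\<Sum>j<N. w z j * (a j \<bullet> v))) * gauss z \<partial>lborel)"
proof (rule gauss_integration_by_parts)
  show "((\<lambda>s. w (z + s *\<^sub>R v) i) has_real_derivative
      \<beta> * w (z + t *\<^sub>R v) i * (a i \<bullet> v - (\<Sum>j<N. w (z + t *\<^sub>R v) j * (a j \<bullet> v)))) (at t)" for z t
    unfolding w_def
    by (rule softmax_has_derivative[OF N]) (auto intro!: derivative_eq_intros simp: inner_add_right)
  show cont: "continuous_on UNIV (\<lambda>z. w z i)"
    unfolding w_def by (intro softmax_continuous_on N continuous_intros)
  show "continuous_on UNIV (\<lambda>z. \<beta> * w z i * (a i \<bullet> v - (\<Sum>j<N. w z j * (a j \<bullet> v))))"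
    unfolding w_def by (intro continuous_intros softmax_continuous_on N)
  show "\<bar>w z i\<bar> \<le> 1" for z
    using i by (simp add: w_def softmax_nonneg softmax_le_1)
  have w1: "\<bar>w z j\<bar> \<le> 1" if "j < N" for z j
    using that by (simp add: w_def softmax_nonneg softmax_le_1)
  show "\<bar>\<beta> * w z i * (a i \<bullet> v - (\<Sum>j<N. w z j * (a j \<bullet> v)))\<bar> \<le> \<bar>\<beta>\<bar> * 1 * (\<bar>a i \<bullet> v\<bar> + (\<Sum>j<N. \<bar>a j \<bullet> v\<bar>))" for z
    unfolding abs_mult
  proof (intro mult_mono)
    have "\<bar>\<Sum>j<N. w z j * (a j \<bullet> v)\<bar> \<le> (\<Sum>j<N. \<bar>a j \<bullet> v\<bar>)"
      using w1 by (intro order_trans[OF sum_abs] sum_mono) (auto simp: abs_mult mult_left_le_one_le)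
    then show "\<bar>a i \<bullet> v - (\<Sum>j<N. w z j * (a j \<bullet> v))\<bar> \<le> \<bar>a i \<bullet> v\<bar> + (\<Sum>j<N. \<bar>a j \<bullet> v\<bar>)"
      by linarith
  qed (use w1 i in auto)
qed

text \<open>Since the weights sum to 1, each of the two diagonal parts of the double sum collapses
  to the sum of the \<open>w i * c i i\<close>. The right side sees only pairs: if \<open>c\<close>
  comes from a symmetric bilinear form, the bracket is its quadratic form at a difference.\<close>

lemma weighted_variance:
  fixes w :: "nat \<Rightarrow> real" and c :: "nat \<Rightarrow> nat \<Rightarrow> real"
  assumes w: "(\<Sum>i<N. w i) = 1" and c: "\<And>i j. c i j = c j i"
  shows "(\<Sum>i<N. w i * (c i i - (\<Sum>j<N. w j * c j i)))
    = (\<Sum>i<N. \<Sum>j<N. w i * w j * (c i i + c j j - 2 * c i j)) / 2"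
proof -
  have "(\<Sum>i<N. \<Sum>j<N. w i * w j * (c i i + c j j - 2 * c i j))
    = (\<Sum>i<N. \<Sum>j<N. w i * c i i * w j) + (\<Sum>i<N. \<Sum>j<N. w j * c j j * w i) - 2 * (\<Sum>i<N. \<Sum>j<N. w i * (w j * c j i))"
    by (simp add: c[of _ _] algebra_simps sum.distrib sum_subtractf sum_distrib_left)
  also have "(\<Sum>i<N. \<Sum>j<N. w i * c i i * w j) = (\<Sum>i<N. w i * c i i)"
    by (simp add: w flip: sum_distrib_left)
  also have "(\<Sum>i<N. \<Sum>j<N. w j * c j j * w i) = (\<Sum>i<N. w i * c i i)"
    by (subst sum.swap) (simp add: w flip: sum_distrib_left)
  finally show ?thesis
    by (simp add: algebra_simps sum_subtractf sum_distrib_left)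
qed

section \<open>Interpolation between the two configurations\<close>

definition stretch :: "real \<Rightarrow> 'a \<times> 'a \<Rightarrow> 'a \<times> ('a::euclidean_space)" where
  "stretch \<theta> x = (cos \<theta> *\<^sub>R fst x, sin \<theta> *\<^sub>R snd x)"

definition stretch_deriv :: "real \<Rightarrow> 'a \<times> 'a \<Rightarrow> 'a \<times> ('a::euclidean_space)" where
  "stretch_deriv \<theta> x = (- sin \<theta> *\<^sub>R fst x, cos \<theta> *\<^sub>R snd x)"

text \<open>The indefinite form \<open>Q\<close>; at the difference of \<open>(p i, q i)\<close> and
  \<open>(p j, q j)\<close> it is the squared distance of the \<open>q\<close> points minus that of
  the \<open>p\<close> points.\<close>

definition sq_diff :: "'a \<times> ('a::euclidean_space) \<Rightarrow> real" where
  "sq_diff x = snd x \<bullet> snd x - fst x \<bullet> fst x"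

lemma stretch_inner: "stretch \<theta> x \<bullet> z = cos \<theta> * (fst x \<bullet> fst z) + sin \<theta> * (snd x \<bullet> snd z)"
  by (simp add: stretch_def inner_prod_def)

lemma stretch_deriv_inner:
  "stretch_deriv \<theta> x \<bullet> z = - sin \<theta> * (fst x \<bullet> fst z) + cos \<theta> * (snd x \<bullet> snd z)"
  by (simp add: stretch_deriv_def inner_prod_def)

lemma norm_stretch_deriv_le: "norm (stretch_deriv \<theta> x) \<le> norm x"
proof -
  have "(sin \<theta>)\<^sup>2 * (norm (fst x))\<^sup>2 \<le> (norm (fst x))\<^sup>2" "(cos \<theta>)\<^sup>2 * (norm (snd x))\<^sup>2 \<le> (norm (snd x))\<^sup>2"
    by (simp_all add: mult_left_le_one_le abs_square_le_1)
  then have "(norm (stretch_deriv \<theta> x))\<^sup>2 \<le> (norm x)\<^sup>2"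
    unfolding stretch_deriv_def norm_prod_def by (simp add: power_mult_distrib)
  then show ?thesis using power2_le_imp_le by fastforce
qed

lemma norm_stretch_le: "norm (stretch \<theta> x) \<le> norm x"
proof -
  have "(cos \<theta>)\<^sup>2 * (norm (fst x))\<^sup>2 \<le> (norm (fst x))\<^sup>2" "(sin \<theta>)\<^sup>2 * (norm (snd x))\<^sup>2 \<le> (norm (snd x))\<^sup>2"
    by (simp_all add: mult_left_le_one_le abs_square_le_1)
  then have "(norm (stretch \<theta> x))\<^sup>2 \<le> (norm x)\<^sup>2"
    unfolding stretch_def norm_prod_def by (simp add: power_mult_distrib)
  then show ?thesis using power2_le_imp_le by fastforce
qed

text \<open>Integration by parts replaces \<open>z\<close> by inner products of
  \<open>stretch \<theta> (x j)\<close> with \<open>stretch_deriv \<theta> (x i)\<close>. These are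
  \<open>sin \<theta> * cos \<theta>\<close> times the Gram matrix of the second components minus
  that of the first, so \<open>weighted_variance\<close> turns the sum into one over pairs.\<close>

lemma gauss_softmax_interpolation:
  fixes x :: "nat \<Rightarrow> 'a \<times> ('a::euclidean_space)" and \<beta> :: real
  assumes N: "0 < N"
  defines "w \<equiv> \<lambda>\<theta> z. softmax \<beta> N (\<lambda>j. stretch \<theta> (x j) \<bullet> z)"
  shows "(\<integral>z. (\<Sum>i<N. w \<theta> z i * (stretch_deriv \<theta> (x i) \<bullet> z)) * gauss z \<partial>lborel)
    = \<beta> * sin \<theta> * cos \<theta> / 2 * (\<Sum>i<N. \<Sum>j<N. sq_diff (x i - x j) * (\<integral>z. w \<theta> z i * w \<theta> z j * gauss z \<partial>lborel))"
proof -
  let ?a = "\<lambda>i. stretch \<theta> (x i)" and ?v = "\<lambda>i. stretch_deriv \<theta> (x i)"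
  have wm [measurable]: "(\<lambda>z. w \<theta> z i) \<in> borel_measurable borel" for i unfolding w_def by measurable
  have w1: "\<bar>w \<theta> z i\<bar> \<le> 1" if "i < N" for z i
    using that by (simp add: w_def softmax_nonneg softmax_le_1)
  have int1: "integrable lborel (\<lambda>z. w \<theta> z i * (?v i \<bullet> z) * gauss z)" if "i < N" for i
  proof (rule integrable_times_gauss[of _ 0 "norm (?v i)"])
    show "\<bar>w \<theta> z i * (?v i \<bullet> z)\<bar> \<le> 0 + norm (?v i) * norm z" for z
      using mult_mono[OF w1[OF that, of z] Cauchy_Schwarz_ineq2[of "?v i" z]] by (simp add: abs_mult)
  qed measurable
  have int2: "integrable lborel (\<lambda>z. w \<theta> z i * w \<theta> z j * gauss z)" if "i < N" "j < N" for i j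
  proof (rule integrable_times_gauss[of _ 1 0])
    show "\<bar>w \<theta> z i * w \<theta> z j\<bar> \<le> 1 + 0 * norm z" for z
      using mult_mono[OF w1[OF that(1), of z] w1[OF that(2), of z]] by (simp add: abs_mult)
  qed measurable
  have int3: "integrable lborel (\<lambda>z. \<beta> * w \<theta> z i * (?a i \<bullet> ?v i - (\<Sum>j<N. w \<theta> z j * (?a j \<bullet> ?v i))) * gauss z)" if "i < N" for i
  proof -
    have "integrable lborel (\<lambda>z. w \<theta> z i * gauss z)"
      using w1[OF that] by (intro integrable_times_gauss[of _ 1 0]) auto
    then have "integrable lborel (\<lambda>z. \<beta> * (?a i \<bullet> ?v i) * (w \<theta> z i * gauss z)
        - (\<Sum>j<N. \<beta> * (?a j \<bullet> ?v i) * (w \<theta> z i * w \<theta> z j * gauss z)))"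
      using int2[OF that] by (intro Bochner_Integration.integrable_diff Bochner_Integration.integrable_sum integrable_mult_right) auto
    then show ?thesis
      by (rule Bochner_Integration.integrable_cong[THEN iffD1, rotated 2])
        (auto simp: algebra_simps sum_distrib_left sum_distrib_right)
  qed
  define c where "c i j = snd (x i) \<bullet> snd (x j) - fst (x i) \<bullet> fst (x j)" for i j
  have av: "?a j \<bullet> ?v i = sin \<theta> * cos \<theta> * c j i" for i j
    by (simp add: stretch_def stretch_deriv_def inner_prod_def c_def algebra_simps)
  have cQ: "c i i + c j j - 2 * c i j = sq_diff (x i - x j)" for i j
    by (simp add: c_def sq_diff_def inner_diff inner_commute)
  have pt: "(\<Sum>i<N. \<beta> * w \<theta> z i * (?a i \<bullet> ?v i - (\<Sum>j<N. w \<theta> z j * (?a j \<bullet> ?v i))) * gauss z)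
     = \<beta> * sin \<theta> * cos \<theta> / 2 * (\<Sum>i<N. \<Sum>j<N. sq_diff (x i - x j) * (w \<theta> z i * w \<theta> z j * gauss z))" for z
  proof -
    have "(\<Sum>i<N. \<beta> * w \<theta> z i * (?a i \<bullet> ?v i - (\<Sum>j<N. w \<theta> z j * (?a j \<bullet> ?v i))) * gauss z)
      = \<beta> * sin \<theta> * cos \<theta> * gauss z * (\<Sum>i<N. w \<theta> z i * (c i i - (\<Sum>j<N. w \<theta> z j * c j i)))"
      unfolding av by (simp add: sum_distrib_left sum_distrib_right algebra_simps)
    also have "(\<Sum>i<N. w \<theta> z i * (c i i - (\<Sum>j<N. w \<theta> z j * c j i)))
      = (\<Sum>i<N. \<Sum>j<N. w \<theta> z i * w \<theta> z j * (c i i + c j j - 2 * c i j)) / 2"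
      by (rule weighted_variance) (auto simp: w_def softmax_sum[OF N] c_def inner_commute)
    also have "\<beta> * sin \<theta> * cos \<theta> * gauss z * ((\<Sum>i<N. \<Sum>j<N. w \<theta> z i * w \<theta> z j * (c i i + c j j - 2 * c i j)) / 2)
      = \<beta> * sin \<theta> * cos \<theta> / 2 * (\<Sum>i<N. \<Sum>j<N. sq_diff (x i - x j) * (w \<theta> z i * w \<theta> z j * gauss z))"
      unfolding cQ by (simp add: sum_distrib_left mult_ac)
    finally show ?thesis .
  qed
  have "(\<integral>z. (\<Sum>i<N. w \<theta> z i * (?v i \<bullet> z)) * gauss z \<partial>lborel) = (\<Sum>i<N. \<integral>z. w \<theta> z i * (?v i \<bullet> z) * gauss z \<partial>lborel)"
    unfolding sum_distrib_right using int1 by (intro Bochner_Integration.integral_sum) auto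
  also have "\<dots> = (\<Sum>i<N. \<integral>z. \<beta> * w \<theta> z i * (?a i \<bullet> ?v i - (\<Sum>j<N. w \<theta> z j * (?a j \<bullet> ?v i))) * gauss z \<partial>lborel)"
    unfolding w_def by (intro sum.cong refl gauss_softmax_integration_by_parts N) auto
  also have "\<dots> = (\<integral>z. (\<Sum>i<N. \<beta> * w \<theta> z i * (?a i \<bullet> ?v i - (\<Sum>j<N. w \<theta> z j * (?a j \<bullet> ?v i))) * gauss z) \<partial>lborel)"
    using int3 by (intro Bochner_Integration.integral_sum[symmetric]) auto
  also have "\<dots> = \<beta> * sin \<theta> * cos \<theta> / 2 * (\<integral>z. (\<Sum>i<N. \<Sum>j<N. sq_diff (x i - x j) * (w \<theta> z i * w \<theta> z j * gauss z)) \<partial>lborel)"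
    unfolding pt by simp
  also have "(\<integral>z. (\<Sum>i<N. \<Sum>j<N. sq_diff (x i - x j) * (w \<theta> z i * w \<theta> z j * gauss z)) \<partial>lborel)
    = (\<Sum>i<N. \<integral>z. (\<Sum>j<N. sq_diff (x i - x j) * (w \<theta> z i * w \<theta> z j * gauss z)) \<partial>lborel)"
    using int2 by (intro Bochner_Integration.integral_sum Bochner_Integration.integrable_sum integrable_mult_right) auto
  also have "\<dots> = (\<Sum>i<N. \<Sum>j<N. \<integral>z. sq_diff (x i - x j) * (w \<theta> z i * w \<theta> z j * gauss z) \<partial>lborel)"
    using int2 by (intro sum.cong refl Bochner_Integration.integral_sum integrable_mult_right) auto
  also have "\<dots> = (\<Sum>i<N. \<Sum>j<N. sq_diff (x i - x j) * (\<integral>z. w \<theta> z i * w \<theta> z j * gauss z \<partial>lborel))"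
    by simp
  finally show ?thesis .
qed

text \<open>The left side of \<open>gauss_softmax_interpolation\<close> is the \<theta>-derivative
  taken under the integral sign. The fundamental theorem is used for each fixed \<open>z\<close> and
  the order of integration is then exchanged, with \<open>C * norm z * gauss z\<close> as integrable
  bound on the compact range of angles.\<close>

lemma
  fixes x :: "nat \<Rightarrow> 'a \<times> ('a::euclidean_space)" and \<beta> :: real
  assumes N: "0 < N" and \<beta>: "0 < \<beta>"
  defines "w \<equiv> \<lambda>\<theta> z. softmax \<beta> N (\<lambda>j. stretch \<theta> (x j) \<bullet> z)"
  defines "R \<equiv> \<lambda>\<theta>. indicator {0..pi/2} \<theta> * (\<beta> * sin \<theta> * cos \<theta> / 2 *
    (\<Sum>i<N. \<Sum>j<N. sq_diff (x i - x j) * (\<integral>z. w \<theta> z i * w \<theta> z j * gauss z \<partial>lborel)))"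
  shows integrable_interpolation: "integrable lborel R"
    and log_sum_exp_interpolation:
      "(\<integral>z. log_sum_exp \<beta> N (\<lambda>j. stretch (pi/2) (x j) \<bullet> z) * gauss z \<partial>lborel)
       - (\<integral>z. log_sum_exp \<beta> N (\<lambda>j. stretch 0 (x j) \<bullet> z) * gauss z \<partial>lborel) = integral\<^sup>L lborel R"
proof -
  define C where "C = (\<Sum>i<N. norm (x i))"
  have C: "0 \<le> C" by (simp add: C_def sum_nonneg)
  define D where "D \<theta> z = (\<Sum>i<N. w \<theta> z i * (stretch_deriv \<theta> (x i) \<bullet> z))" for \<theta> z
  have D_le: "\<bar>D \<theta> z\<bar> \<le> C * norm z" for \<theta> z
  proof -
    have "\<bar>D \<theta> z\<bar> \<le> (\<Sum>i<N. norm (x i) * norm z)"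
      unfolding D_def
    proof (intro order_trans[OF sum_abs] sum_mono)
      fix i assume "i \<in> {..<N}"
      then have "\<bar>w \<theta> z i\<bar> \<le> 1" by (simp add: w_def softmax_nonneg softmax_le_1)
      moreover have "\<bar>stretch_deriv \<theta> (x i) \<bullet> z\<bar> \<le> norm (x i) * norm z"
        using Cauchy_Schwarz_ineq2[of "stretch_deriv \<theta> (x i)" z] mult_right_mono[OF norm_stretch_deriv_le[of \<theta> "x i"] norm_ge_zero[of z]]
        by linarith
      ultimately show "\<bar>w \<theta> z i * (stretch_deriv \<theta> (x i) \<bullet> z)\<bar> \<le> norm (x i) * norm z"
        using mult_mono[of "\<bar>w \<theta> z i\<bar>" 1] by (simp add: abs_mult)
    qed
    then show ?thesis by (simp add: C_def sum_distrib_right)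
  qed
  have Dm: "(\<lambda>(\<theta>, z). D \<theta> z) \<in> borel_measurable (lborel \<Otimes>\<^sub>M lborel)"
  proof -
    have "continuous_on UNIV (\<lambda>y. D (fst y) (snd y))"
      unfolding D_def w_def stretch_inner stretch_deriv_inner
      by (intro continuous_intros softmax_continuous_on N)
    then have "(\<lambda>y. D (fst y) (snd y)) \<in> borel_measurable (borel :: (real \<times> 'a \<times> 'a) measure)"
      by (rule borel_measurable_continuous_onI)
    then show ?thesis by (simp add: lborel_prod case_prod_beta' borel_prod)
  qed
  let ?f = "\<lambda>\<theta> z. indicator {0..pi/2} \<theta> * (D \<theta> z * gauss z)"
  have intCg: "integrable lborel (\<lambda>z::'a \<times> 'a. C * norm z * gauss z)"
    using C by (intro integrable_times_gauss[of _ 0 C]) (auto simp: abs_mult)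
  have bound: "integrable (lborel \<Otimes>\<^sub>M lborel) (\<lambda>(\<theta>::real, z::'a \<times> 'a). indicator {0..pi/2} \<theta> * (C * norm z * gauss z))"
  proof (rule lborel_pair.Fubini_integrable)
    show "integrable lborel (\<lambda>\<theta>::real. \<integral>z. norm (case (\<theta>, z::'a \<times> 'a) of (\<theta>, z) \<Rightarrow> indicator {0..pi/2} \<theta> * (C * norm z * gauss z)) \<partial>lborel)"
      by (simp add: abs_mult)
    show "AE \<theta> in lborel. integrable lborel (\<lambda>z. case (\<theta>::real, z::'a \<times> 'a) of (\<theta>, z) \<Rightarrow> indicator {0..pi/2} \<theta> * (C * norm z * gauss z))"
      using intCg by auto
  qed measurable
  have prod: "integrable (lborel \<Otimes>\<^sub>M lborel) (case_prod ?f)"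
  proof (rule Bochner_Integration.integrable_bound[OF bound])
    have "(\<lambda>y::real \<times> 'a \<times> 'a. indicator {0..pi/2} (fst y) * ((case y of (\<theta>, z) \<Rightarrow> D \<theta> z) * gauss (snd y)))
      \<in> borel_measurable (lborel \<Otimes>\<^sub>M lborel)"
      using Dm by measurable
    then show "case_prod ?f \<in> borel_measurable (lborel \<Otimes>\<^sub>M lborel)"
      by (simp add: case_prod_beta')
    show "AE y in lborel \<Otimes>\<^sub>M lborel. norm (case_prod ?f y) \<le> norm (case y of (\<theta>, z) \<Rightarrow> indicator {0..pi/2} \<theta> * (C * norm z * gauss z))"
      using D_le C by (auto simp: abs_mult indicator_def intro!: mult_right_mono)
  qed
  have R: "(\<integral>z. ?f \<theta> z \<partial>lborel) = R \<theta>" for \<theta>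
    unfolding R_def w_def D_def integral_mult_right_zero
    by (subst gauss_softmax_interpolation[OF N]) simp
  show "integrable lborel R"
    using lborel_pair.integrable_fst[OF prod] unfolding R by simp
  have FTC: "(\<integral>\<theta>. ?f \<theta> z \<partial>lborel) = log_sum_exp \<beta> N (\<lambda>j. stretch (pi/2) (x j) \<bullet> z) * gauss z
      - log_sum_exp \<beta> N (\<lambda>j. stretch 0 (x j) \<bullet> z) * gauss z" for z
  proof -
    have "(\<integral>\<theta>. D \<theta> z * indicator {0..pi/2} \<theta> \<partial>lborel)
       = log_sum_exp \<beta> N (\<lambda>j. stretch (pi/2) (x j) \<bullet> z) - log_sum_exp \<beta> N (\<lambda>j. stretch 0 (x j) \<bullet> z)"
    proof (rule integral_FTC_Icc_real)
      show "((\<lambda>\<theta>. log_sum_exp \<beta> N (\<lambda>j. stretch \<theta> (x j) \<bullet> z)) has_real_derivative D \<theta> z) (at \<theta>)" for \<theta>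
        unfolding D_def w_def
        by (rule log_sum_exp_has_derivative[OF N \<beta>])
          (auto simp: stretch_inner stretch_deriv_inner intro!: derivative_eq_intros)
      have "continuous_on UNIV (\<lambda>\<theta>. D \<theta> z)"
        unfolding D_def w_def stretch_inner stretch_deriv_inner
        by (intro continuous_intros softmax_continuous_on N)
      then show "isCont (\<lambda>\<theta>. D \<theta> z) \<theta>" for \<theta> by (simp add: continuous_on_eq_continuous_at)
    qed simp
    moreover have "(\<integral>\<theta>. ?f \<theta> z \<partial>lborel) = (\<integral>\<theta>. (D \<theta> z * indicator {0..pi/2} \<theta>) * gauss z \<partial>lborel)"
      by (simp add: mult_ac)
    ultimately show ?thesis by (simp add: left_diff_distrib)
  qed
  have L: "integrable lborel (\<lambda>z. log_sum_exp \<beta> N (\<lambda>j. stretch \<theta> (x j) \<bullet> z) * gauss z)" for \<theta>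
  proof (rule integrable_times_gauss[of _ "ln N / \<beta>" "\<Sum>i<N. norm (stretch \<theta> (x i))"])
    fix z
    have "ln (real N) / \<beta> \<ge> 0" using N \<beta> by simp
    then show "\<bar>log_sum_exp \<beta> N (\<lambda>j. stretch \<theta> (x j) \<bullet> z)\<bar> \<le> ln N / \<beta> + (\<Sum>i<N. norm (stretch \<theta> (x i))) * norm z"
      using log_sum_exp_bounds[OF N \<beta>, of "\<lambda>i. stretch \<theta> (x i)" z] abs_max_inner_le[OF N, of "\<lambda>i. stretch \<theta> (x i)" z]
      by linarith
  qed measurable
  show "(\<integral>z. log_sum_exp \<beta> N (\<lambda>j. stretch (pi/2) (x j) \<bullet> z) * gauss z \<partial>lborel)
       - (\<integral>z. log_sum_exp \<beta> N (\<lambda>j. stretch 0 (x j) \<bullet> z) * gauss z \<partial>lborel) = integral\<^sup>L lborel R"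
    using lborel_pair.Fubini_integral[OF prod] L unfolding FTC R by simp
qed

section \<open>Softmax mass along an edge\<close>

text \<open>\<open>u\<close> is a functional exposing the edge. Points \<open>x k\<close> off the
  edge lie strictly below it at \<open>u\<close>, hence below \<open>x a\<close> for all
  \<open>z\<close> near \<open>u\<close>; points on the edge are convex combinations of its ends, so
  their bound holds for every \<open>z\<close>. Finitely many \<open>k\<close> admit a common
  radius.\<close>

lemma edge_functional_neighbourhood:
  fixes x :: "nat \<Rightarrow> 'v::euclidean_space"
  assumes face: "closed_segment (x a) (x b) face_of convex hull (x ` {..<N})" and ab: "a < N" "b < N"
  obtains u r where "0 < r" "u \<bullet> x a = u \<bullet> x b"
    "\<And>z k. z \<in> ball u r \<Longrightarrow> k < N \<Longrightarrow> x k \<bullet> z \<le> max (x a \<bullet> z) (x b \<bullet> z)"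
proof -
  let ?P = "convex hull (x ` {..<N})" and ?F = "closed_segment (x a) (x b)"
  have "polytope ?P" by (auto simp: polytope_def)
  then obtain u \<alpha> where u: "?P \<subseteq> {z. u \<bullet> z \<le> \<alpha>}" "?F = ?P \<inter> {z. u \<bullet> z = \<alpha>}"
    using exposed_face_of_polyhedron[OF polytope_imp_polyhedron, of ?P ?F] face
    unfolding exposed_face_of_def by auto
  have ua: "u \<bullet> x a = \<alpha>" "u \<bullet> x b = \<alpha>" using u(2) ends_in_segment[of "x a" "x b"] by auto
  have "\<forall>\<^sub>F z in nhds u. x k \<bullet> z \<le> max (x a \<bullet> z) (x b \<bullet> z)" if k: "k < N" for k
  proof (cases "x k \<in> ?F")
    case True
    then obtain t where t: "0 \<le> t" "t \<le> 1" "x k = (1 - t) *\<^sub>R x a + t *\<^sub>R x b"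
      by (auto simp: closed_segment_def)
    have "x k \<bullet> z \<le> max (x a \<bullet> z) (x b \<bullet> z)" for z
    proof -
      have "x k \<bullet> z = (1 - t) * (x a \<bullet> z) + t * (x b \<bullet> z)" by (simp add: t(3) inner_add_left)
      also have "\<dots> \<le> (1 - t) * max (x a \<bullet> z) (x b \<bullet> z) + t * max (x a \<bullet> z) (x b \<bullet> z)"
        using t by (intro add_mono mult_left_mono) auto
      finally show ?thesis by (simp add: algebra_simps)
    qed
    then show ?thesis by simp
  next
    case False
    have "x k \<in> ?P" using k by (intro hull_inc) auto
    moreover from this have "u \<bullet> x k \<le> \<alpha>" using u(1) by blast
    moreover have "u \<bullet> x k \<noteq> \<alpha>" using False \<open>x k \<in> ?P\<close> unfolding u(2) by blast
    ultimately have "u \<bullet> x k < \<alpha>" by simp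
    then have "0 < u \<bullet> (x a - x k)" using ua by (simp add: inner_diff_right)
    then have "0 < (x a - x k) \<bullet> u" by (simp add: inner_commute)
    moreover have "((\<lambda>z. (x a - x k) \<bullet> z) \<longlongrightarrow> (x a - x k) \<bullet> u) (nhds u)"
      by (intro tendsto_intros) (simp add: filterlim_ident)
    ultimately have "\<forall>\<^sub>F z in nhds u. 0 < (x a - x k) \<bullet> z" by (rule order_tendstoD(1)[rotated])
    then show ?thesis by eventually_elim (simp add: inner_diff_left)
  qed
  then have "\<forall>\<^sub>F z in nhds u. \<forall>k\<in>{..<N}. x k \<bullet> z \<le> max (x a \<bullet> z) (x b \<bullet> z)"
    by (intro eventually_ball_finite) auto
  then obtain r where "r > 0" "\<And>z. dist z u < r \<Longrightarrow> \<forall>k\<in>{..<N}. x k \<bullet> z \<le> max (x a \<bullet> z) (x b \<bullet> z)"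
    unfolding eventually_nhds_metric by blast
  then show thesis using that[of r u] ua by (auto simp: dist_commute)
qed

text \<open>If no score exceeds that of \<open>i\<close> by more than \<open>1 / \<beta>\<close>,
  every term of the denominator is at most \<open>exp 1\<close> times the numerator.\<close>

lemma softmax_ge:
  assumes N: "0 < N" and \<beta>: "0 < \<beta>" and le: "\<And>k. k < N \<Longrightarrow> y k \<le> y i + 1 / \<beta>"
  shows "exp (- 1) / real N \<le> softmax \<beta> N y i"
proof -
  have "(\<Sum>k<N. exp (\<beta> * y k)) \<le> (\<Sum>k<N. exp (\<beta> * y i + 1))"
  proof (intro sum_mono)
    fix k assume "k \<in> {..<N}"
    then have "\<beta> * y k \<le> \<beta> * (y i + 1 / \<beta>)" using le \<beta> by (intro mult_left_mono) auto
    then show "exp (\<beta> * y k) \<le> exp (\<beta> * y i + 1)" using \<beta> by (simp add: algebra_simps)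
  qed
  then have "(\<Sum>k<N. exp (\<beta> * y k)) \<le> real N * exp (\<beta> * y i + 1)" by simp
  then have "exp (\<beta> * y i) / (real N * exp (\<beta> * y i + 1)) \<le> softmax \<beta> N y i"
    unfolding softmax_def using sum_exp_pos[OF N, of \<beta> y] by (intro divide_left_mono) auto
  then show ?thesis by (simp add: exp_add exp_minus field_simps)
qed

lemma sin_cos_ge_half:
  assumes "\<theta> \<in> {pi/6..pi/3}" shows "1 / 2 \<le> sin \<theta>" "1 / 2 \<le> cos \<theta>"
proof -
  have "0 < pi" by simp
  then have "- (pi/2) \<le> pi/6" "pi/6 \<le> \<theta>" "\<theta> \<le> pi/2" "0 \<le> \<theta>" "\<theta> \<le> pi/3" "pi/3 \<le> pi"
    using assms by auto
  then show "1 / 2 \<le> sin \<theta>" "1 / 2 \<le> cos \<theta>"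
    using sin_monotone_2pi_le[of "pi/6" \<theta>] cos_monotone_0_pi_le[of \<theta> "pi/3"] by (simp_all add: sin_30 cos_60)
qed

text \<open>Where \<open>stretch \<theta> z\<close> is near the exposing functional, the ends of the
  edge dominate all scores. In the slab where their two scores differ by at most
  \<open>1 / \<beta>\<close>, both weights are at least \<open>exp (- 1) / N\<close>, and the slab
  has volume at least of order \<open>1 / \<beta>\<close>. Keeping \<theta> away from 0 and
  \<open>pi/2\<close> makes the constants independent of it.\<close>

lemma edge_softmax_mass:
  fixes x :: "nat \<Rightarrow> 'a \<times> ('a::euclidean_space)"
  assumes face: "closed_segment (x a) (x b) face_of convex hull (x ` {..<N})" and ab: "a < N" "b < N"
  obtains \<kappa> where "0 < \<kappa>" "\<And>\<beta> \<theta>. 1 \<le> \<beta> \<Longrightarrow> \<theta> \<in> {pi/6..pi/3} \<Longrightarrow>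
    \<kappa> / \<beta> \<le> (\<integral>z. softmax \<beta> N (\<lambda>j. stretch \<theta> (x j) \<bullet> z) a * softmax \<beta> N (\<lambda>j. stretch \<theta> (x j) \<bullet> z) b * gauss z \<partial>lborel)"
proof -
  have N: "0 < N" using ab by simp
  obtain u r where r: "0 < r" and u: "u \<bullet> x a = u \<bullet> x b"
    and nb: "\<And>z k. z \<in> ball u r \<Longrightarrow> k < N \<Longrightarrow> x k \<bullet> z \<le> max (x a \<bullet> z) (x b \<bullet> z)"
    by (rule edge_functional_neighbourhood[OF assms]) (rule that; assumption)
  \<comment> \<open>The added 1 keeps the bound positive when \<open>x a = x b\<close>.\<close>
  have A: "0 < norm (x a - x b) + 1" by (simp add: add_nonneg_pos)
  obtain c where c: "0 < c"
    and slab: "\<And>(z0::'a \<times> 'a) v \<epsilon>. norm v \<le> norm (x a - x b) + 1 \<Longrightarrow> v \<bullet> z0 = 0 \<Longrightarrow> 0 < \<epsilon> \<Longrightarrow> \<epsilon> \<le> 1 \<Longrightarrow>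
      c * \<epsilon> \<le> measure lborel (ball z0 r \<inter> {z. \<bar>v \<bullet> z\<bar> \<le> \<epsilon>})"
    by (rule measure_ball_slab_ge[OF r A]) (rule that; assumption)
  \<comment> \<open>A lower bound for \<open>gauss\<close> on every ball of radius \<open>r\<close>
    whose centre has norm at most \<open>2 * norm u\<close>.\<close>
  define g where "g = exp (- (2 * norm u + r)\<^sup>2 / 2)"
  define m where "m = exp (- 1) / real N"
  have m: "0 < m" using N by (simp add: m_def)
  have g: "0 < g" by (simp add: g_def)
  show thesis
  proof (rule that[of "m * m * g * c"])
    show "0 < m * m * g * c" using m g c by simp
    fix \<beta> \<theta> :: real assume \<beta>: "1 \<le> \<beta>" and \<theta>: "\<theta> \<in> {pi/6..pi/3}"
    note sc = sin_cos_ge_half[OF \<theta>]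
    let ?w = "\<lambda>z. softmax \<beta> N (\<lambda>j. stretch \<theta> (x j) \<bullet> z)"
    \<comment> \<open>The preimage of \<open>u\<close> under \<open>stretch \<theta>\<close>; both
      components grow by a factor of at most 2, since sine and cosine are at least 1/2.\<close>
    define z0 where "z0 = (fst u /\<^sub>R cos \<theta>, snd u /\<^sub>R sin \<theta>)"
    define v where "v = stretch \<theta> (x a - x b)"
    \<comment> \<open>Self-adjointness: the scores of the stretched points at \<open>z\<close> are
      the scores of the original points at \<open>stretch \<theta> z\<close>, where the
      neighbourhood of \<open>u\<close> applies.\<close>
    have swap: "stretch \<theta> y \<bullet> z = y \<bullet> stretch \<theta> z" for y z :: "'a \<times> 'a"
      by (simp add: stretch_def inner_prod_def)
    have diff: "stretch \<theta> (y - z) = stretch \<theta> y - stretch \<theta> z" for y z :: "'a \<times> 'a"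
      by (simp add: stretch_def scaleR_diff_right)
    have sz0: "stretch \<theta> z0 = u" using sc by (simp add: stretch_def z0_def)
    have nz0: "norm z0 \<le> 2 * norm u"
    proof -
      have inv: "inverse s \<le> 2" "0 \<le> inverse s" if "1 / 2 \<le> s" for s :: real
        using that by (auto simp: field_simps)
      have "(inverse (cos \<theta>) * norm (fst u))\<^sup>2 \<le> (2 * norm (fst u))\<^sup>2" "(inverse (sin \<theta>) * norm (snd u))\<^sup>2 \<le> (2 * norm (snd u))\<^sup>2"
        using inv[OF sc(1)] inv[OF sc(2)] by (intro power_mono mult_right_mono; simp)+
      moreover have "(norm z0)\<^sup>2 = (inverse (cos \<theta>) * norm (fst u))\<^sup>2 + (inverse (sin \<theta>) * norm (snd u))\<^sup>2"
        using sc by (simp add: z0_def norm_prod_def power_mult_distrib)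
      moreover have "(2 * norm u)\<^sup>2 = (2 * norm (fst u))\<^sup>2 + (2 * norm (snd u))\<^sup>2"
        by (simp add: norm_prod_def power_mult_distrib)
      ultimately have "(norm z0)\<^sup>2 \<le> (2 * norm u)\<^sup>2" by linarith
      then show ?thesis by (rule power2_le_imp_le) simp
    qed
    define S where "S = ball z0 r \<inter> {z. \<bar>v \<bullet> z\<bar> \<le> 1 / \<beta>}"
    have Sm [measurable]: "S \<in> sets borel" unfolding S_def by measurable
    have "v \<bullet> z0 = 0" unfolding v_def swap sz0 using u by (simp add: inner_diff_right inner_commute)
    moreover have "norm v \<le> norm (x a - x b) + 1"
      unfolding v_def using norm_stretch_le[of \<theta> "x a - x b"] by simp
    ultimately have mS: "c * (1 / \<beta>) \<le> measure lborel S"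
      unfolding S_def using \<beta> by (intro slab) auto
    have low: "m * m * g * indicator S z \<le> ?w z a * ?w z b * gauss z" for z
    proof (cases "z \<in> S")
      case True
      then have z: "norm (z - z0) < r" "\<bar>v \<bullet> z\<bar> \<le> 1 / \<beta>" by (auto simp: S_def dist_norm norm_minus_commute)
      have "norm (stretch \<theta> z - u) < r"
        using norm_stretch_le[of \<theta> "z - z0"] z(1) by (simp add: diff sz0)
      then have "stretch \<theta> z \<in> ball u r" by (simp add: dist_norm norm_minus_commute)
      from nb[OF this] have k: "stretch \<theta> (x k) \<bullet> z \<le> max (stretch \<theta> (x a) \<bullet> z) (stretch \<theta> (x b) \<bullet> z)" if "k < N" for k
        using that by (simp add: swap)
      have "\<bar>stretch \<theta> (x a) \<bullet> z - stretch \<theta> (x b) \<bullet> z\<bar> \<le> 1 / \<beta>"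
        using z(2) by (simp add: v_def diff inner_diff_left)
      then have le: "stretch \<theta> (x k) \<bullet> z \<le> stretch \<theta> (x a) \<bullet> z + 1 / \<beta>" "stretch \<theta> (x k) \<bullet> z \<le> stretch \<theta> (x b) \<bullet> z + 1 / \<beta>"
        if "k < N" for k using k[OF that] by linarith+
      have w: "m \<le> ?w z a" "m \<le> ?w z b"
        unfolding m_def using \<beta> le by (auto intro!: softmax_ge[OF N])
      have "norm z \<le> 2 * norm u + r" using z(1) nz0 norm_triangle_sub[of z z0] by linarith
      then have "g \<le> gauss z" unfolding g_def gauss_def using r by (simp add: power_mono)
      then show ?thesis using True w m g by (auto intro!: mult_mono)
    qed (simp add: softmax_nonneg)
    have "m * m * g * c / \<beta> \<le> m * m * g * measure lborel S"
      using mult_left_mono[OF mS, of "m * m * g"] m g by simp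
    also have "\<dots> = (\<integral>z. m * m * g * indicator S z \<partial>lborel)" by simp
    also have "\<dots> \<le> (\<integral>z. ?w z a * ?w z b * gauss z \<partial>lborel)"
    proof (rule integral_mono)
      have "emeasure lborel S \<le> emeasure lborel (ball z0 r)" by (intro emeasure_mono) (auto simp: S_def)
      then have "emeasure lborel S < \<infinity>" using emeasure_lborel_ball_finite[of z0 r] by (metis infinity_ennreal_def le_less_trans)
      then show "integrable lborel (\<lambda>z. m * m * g * indicator S z)"
        by (intro integrable_mult_right integrable_real_indicator) auto
      show "integrable lborel (\<lambda>z. ?w z a * ?w z b * gauss z)"
      proof (rule integrable_times_gauss[of _ 1 0])
        show "\<bar>?w z a * ?w z b\<bar> \<le> 1 + 0 * norm z" for z
          using ab softmax_nonneg[of \<beta> N] softmax_le_1[of _ N \<beta>] by (simp add: abs_mult mult_le_one)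
      qed measurable
    qed (rule low)
    finally show "m * m * g * c / \<beta> \<le> (\<integral>z. ?w z a * ?w z b * gauss z \<partial>lborel)" .
  qed
qed

section \<open>Comparison of mean widths\<close>

text \<open>After integration the smoothed maximum exceeds the true one by at most
  \<open>K / \<beta>\<close>, so a bound \<open>c\<close> valid for all
  \<open>\<beta> \<ge> 1\<close> survives the limit of large \<beta>.\<close>

lemma gauss_max_difference_ge:
  fixes x :: "nat \<Rightarrow> 'a \<times> ('a::euclidean_space)"
  assumes N: "0 < N"
    and c: "\<And>\<beta>. 1 \<le> \<beta> \<Longrightarrow> c \<le> (\<integral>z. log_sum_exp \<beta> N (\<lambda>j. stretch (pi/2) (x j) \<bullet> z) * gauss z \<partial>lborel)
       - (\<integral>z. log_sum_exp \<beta> N (\<lambda>j. stretch 0 (x j) \<bullet> z) * gauss z \<partial>lborel)"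
  shows "c \<le> (\<integral>z. max_inner (\<lambda>i. stretch (pi/2) (x i)) N z * gauss z \<partial>lborel)
    - (\<integral>z. max_inner (\<lambda>i. stretch 0 (x i)) N z * gauss z \<partial>lborel)"
proof -
  define \<Phi> where "\<Phi> \<theta> = (\<integral>z. max_inner (\<lambda>i. stretch \<theta> (x i)) N z * gauss z \<partial>lborel)" for \<theta>
  define L where "L \<beta> \<theta> = (\<integral>z. log_sum_exp \<beta> N (\<lambda>j. stretch \<theta> (x j) \<bullet> z) * gauss z \<partial>lborel)" for \<beta> \<theta>
  define K where "K = ln (real N) * integral\<^sup>L lborel (gauss :: 'a \<times> 'a \<Rightarrow> real)"
  have intM: "integrable lborel (\<lambda>z. max_inner (\<lambda>i. stretch \<theta> (x i)) N z * gauss z)" for \<theta>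
    using abs_max_inner_le[OF N, of "\<lambda>i. stretch \<theta> (x i)"] by (intro integrable_times_gauss[of _ 0]) auto
  have L: "\<Phi> \<theta> \<le> L \<beta> \<theta>" "L \<beta> \<theta> \<le> \<Phi> \<theta> + K / \<beta>" if \<beta>: "1 \<le> \<beta>" for \<beta> \<theta>
  proof -
    have \<beta>': "0 < \<beta>" using \<beta> by simp
    note b = log_sum_exp_bounds[OF N \<beta>', of "\<lambda>i. stretch \<theta> (x i)"]
    have intL: "integrable lborel (\<lambda>z. log_sum_exp \<beta> N (\<lambda>j. stretch \<theta> (x j) \<bullet> z) * gauss z)"
    proof (rule integrable_times_gauss[of _ "ln N / \<beta>" "\<Sum>i<N. norm (stretch \<theta> (x i))"])
      fix z
      have "ln (real N) / \<beta> \<ge> 0" using N \<beta> by simp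
      then show "\<bar>log_sum_exp \<beta> N (\<lambda>j. stretch \<theta> (x j) \<bullet> z)\<bar> \<le> ln N / \<beta> + (\<Sum>i<N. norm (stretch \<theta> (x i))) * norm z"
        using b[of z] abs_max_inner_le[OF N, of "\<lambda>i. stretch \<theta> (x i)" z] by linarith
    qed measurable
    show "\<Phi> \<theta> \<le> L \<beta> \<theta>"
      unfolding \<Phi>_def L_def using b(1) by (intro integral_mono intM intL mult_right_mono) auto
    have "L \<beta> \<theta> \<le> (\<integral>z. max_inner (\<lambda>i. stretch \<theta> (x i)) N z * gauss z + ln N / \<beta> * gauss z \<partial>lborel)"
      unfolding L_def
    proof (intro integral_mono intL Bochner_Integration.integrable_add intM integrable_mult_right integrable_gauss)
      show "log_sum_exp \<beta> N (\<lambda>j. stretch \<theta> (x j) \<bullet> z) * gauss z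
        \<le> max_inner (\<lambda>i. stretch \<theta> (x i)) N z * gauss z + ln N / \<beta> * gauss z" for z
        unfolding distrib_right[symmetric] using b(2) by (intro mult_right_mono) auto
    qed
    also have "\<dots> = \<Phi> \<theta> + K / \<beta>"
      by (subst Bochner_Integration.integral_add[OF intM integrable_mult_right[OF integrable_gauss]])
        (simp add: \<Phi>_def K_def)
    finally show "L \<beta> \<theta> \<le> \<Phi> \<theta> + K / \<beta>" .
  qed
  have "((\<lambda>\<beta>. \<Phi> (pi/2) + K / \<beta> - \<Phi> 0) \<longlongrightarrow> \<Phi> (pi/2) + 0 - \<Phi> 0) at_top"
    by (intro tendsto_intros tendsto_divide_0[OF tendsto_const] filterlim_at_top_imp_at_infinity filterlim_ident)
  moreover have "\<forall>\<^sub>F \<beta> in at_top. c \<le> \<Phi> (pi/2) + K / \<beta> - \<Phi> 0"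
    using eventually_ge_at_top[of 1]
  proof eventually_elim
    case (elim \<beta>)
    then show ?case using c[of \<beta>] L[of \<beta> "pi/2"] L[of \<beta> 0] unfolding L_def[symmetric] by linarith
  qed
  ultimately have "c \<le> \<Phi> (pi/2) + 0 - \<Phi> 0"
    by (rule tendsto_lowerbound) simp
  then show ?thesis by (simp add: \<Phi>_def)
qed

text \<open>All terms of the interpolation formula are nonnegative on [0, \<open>pi/2\<close>],
  which gives the first claim. For the second, one edge term is kept: the factor \<beta> of the
  formula cancels the \<open>1 / \<beta>\<close> of \<open>edge_softmax_mass\<close>, so the gain
  stays above a positive constant uniformly in \<beta>.\<close>

lemma gauss_max_comparison:
  fixes x :: "nat \<Rightarrow> 'a \<times> ('a::euclidean_space)"
  assumes N: "0 < N" and pos: "\<And>i j. i < N \<Longrightarrow> j < N \<Longrightarrow> 0 \<le> sq_diff (x i - x j)"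
  defines "\<Phi> \<equiv> \<lambda>\<theta>. \<integral>z. max_inner (\<lambda>i. stretch \<theta> (x i)) N z * gauss z \<partial>lborel"
  shows "\<Phi> 0 \<le> \<Phi> (pi/2)"
    and "closed_segment (x a) (x b) face_of convex hull (x ` {..<N}) \<Longrightarrow> a < N \<Longrightarrow> b < N \<Longrightarrow>
      0 < sq_diff (x a - x b) \<Longrightarrow> \<Phi> 0 < \<Phi> (pi/2)"
proof -
  define w where "w \<beta> \<theta> z = softmax \<beta> N (\<lambda>j. stretch \<theta> (x j) \<bullet> z)" for \<beta> \<theta> z
  define I where "I \<beta> \<theta> i j = (\<integral>z. w \<beta> \<theta> z i * w \<beta> \<theta> z j * gauss z \<partial>lborel)" for \<beta> \<theta> i j
  define R where "R \<beta> \<theta> = indicator {0..pi/2} \<theta> * (\<beta> * sin \<theta> * cos \<theta> / 2 *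
    (\<Sum>i<N. \<Sum>j<N. sq_diff (x i - x j) * I \<beta> \<theta> i j))" for \<beta> \<theta>
  have R: "integrable lborel (R \<beta>)"
      "(\<integral>z. log_sum_exp \<beta> N (\<lambda>j. stretch (pi/2) (x j) \<bullet> z) * gauss z \<partial>lborel)
       - (\<integral>z. log_sum_exp \<beta> N (\<lambda>j. stretch 0 (x j) \<bullet> z) * gauss z \<partial>lborel) = integral\<^sup>L lborel (R \<beta>)"
    if "1 \<le> \<beta>" for \<beta>
    using integrable_interpolation[OF N, of \<beta> x] log_sum_exp_interpolation[OF N, of \<beta> x] that
    unfolding R_def I_def w_def by (simp_all add: fun_eq_iff)
  have I0: "0 \<le> I \<beta> \<theta> i j" for \<beta> \<theta> i j
    unfolding I_def w_def by (intro Bochner_Integration.integral_nonneg mult_nonneg_nonneg softmax_nonneg) simp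
  have sc: "0 \<le> sin \<theta> * cos \<theta>" if "\<theta> \<in> {0..pi/2}" for \<theta>
    using that by (intro mult_nonneg_nonneg sin_ge_zero cos_ge_zero) auto
  have R0: "0 \<le> R \<beta> \<theta>" if "1 \<le> \<beta>" for \<beta> \<theta>
  proof (cases "\<theta> \<in> {0..pi/2}")
    case True
    have "0 \<le> \<beta> * (sin \<theta> * cos \<theta>) / 2" using that sc[OF True] by simp
    then show ?thesis unfolding R_def using I0 pos
      by (intro mult_nonneg_nonneg sum_nonneg) (auto simp: mult.assoc)
  qed (simp add: R_def)
  show "\<Phi> 0 \<le> \<Phi> (pi/2)"
    unfolding \<Phi>_def using gauss_max_difference_ge[OF N, of 0 x] R(2) R0 by (simp add: Bochner_Integration.integral_nonneg)
  assume face: "closed_segment (x a) (x b) face_of convex hull (x ` {..<N})" and ab: "a < N" "b < N"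
    and d: "0 < sq_diff (x a - x b)"
  obtain \<kappa> where \<kappa>: "0 < \<kappa>" "\<And>\<beta> \<theta>. 1 \<le> \<beta> \<Longrightarrow> \<theta> \<in> {pi/6..pi/3} \<Longrightarrow> \<kappa> / \<beta> \<le> I \<beta> \<theta> a b"
    by (rule edge_softmax_mass[OF face ab]) (rule that, assumption, simp add: I_def w_def)
  \<comment> \<open>The 8 collects the 1/2 of the formula and the bound 1/4 for
    \<open>sin \<theta> * cos \<theta>\<close> on the middle range of angles.\<close>
  define \<gamma> where "\<gamma> = sq_diff (x a - x b) * \<kappa> / 8"
  have \<gamma>: "0 < \<gamma>" using d \<kappa> by (simp add: \<gamma>_def)
  have low: "\<gamma> * indicator {pi/6..pi/3} \<theta> \<le> R \<beta> \<theta>" if \<beta>: "1 \<le> \<beta>" for \<beta> \<theta>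
  proof (cases "\<theta> \<in> {pi/6..pi/3}")
    case True
    have "0 < pi" by simp
    then have \<theta>: "\<theta> \<in> {0..pi/2}" using True by auto
    have "1 / 2 * (1 / 2) \<le> sin \<theta> * cos \<theta>"
      using sin_cos_ge_half[OF True] by (intro mult_mono) auto
    then have sc4: "\<beta> / 8 \<le> \<beta> * sin \<theta> * cos \<theta> / 2"
      using mult_left_mono[of "1/4" "sin \<theta> * cos \<theta>" \<beta>] \<beta> by (simp add: mult.assoc)
    have "sq_diff (x a - x b) * (\<kappa> / \<beta>) \<le> sq_diff (x a - x b) * I \<beta> \<theta> a b"
      using d \<kappa>(2)[OF \<beta> True] by (intro mult_left_mono) auto
    \<comment> \<open>All other pairs contribute nonnegative terms.\<close>
    also have "\<dots> \<le> (\<Sum>j<N. sq_diff (x a - x j) * I \<beta> \<theta> a j)"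
      using ab pos I0 by (intro member_le_sum) auto
    also have "\<dots> \<le> (\<Sum>i<N. \<Sum>j<N. sq_diff (x i - x j) * I \<beta> \<theta> i j)"
      using ab pos I0 by (intro member_le_sum sum_nonneg) auto
    finally have "\<beta> / 8 * (sq_diff (x a - x b) * (\<kappa> / \<beta>))
        \<le> \<beta> * sin \<theta> * cos \<theta> / 2 * (\<Sum>i<N. \<Sum>j<N. sq_diff (x i - x j) * I \<beta> \<theta> i j)"
      using \<beta> d \<kappa>(1) order_trans[OF _ sc4, of 0] by (intro mult_mono[OF sc4]) simp_all
    also have "\<dots> = R \<beta> \<theta>" using \<theta> by (simp add: R_def)
    finally show ?thesis using True \<beta> by (simp add: \<gamma>_def)
  qed (use R0[OF \<beta>] in simp)
  have "\<gamma> * (pi/6) \<le> integral\<^sup>L lborel (R \<beta>)" if \<beta>: "1 \<le> \<beta>" for \<beta>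
  proof -
    have "\<gamma> * (pi/6) = (\<integral>\<theta>. \<gamma> * indicator {pi/6..pi/3} \<theta> \<partial>lborel)" by simp
    also have "\<dots> \<le> integral\<^sup>L lborel (R \<beta>)"
      by (intro integral_mono R(1)[OF \<beta>] low[OF \<beta>] integrable_mult_right integrable_real_indicator) auto
    finally show ?thesis .
  qed
  then have "\<gamma> * (pi/6) \<le> \<Phi> (pi/2) - \<Phi> 0" unfolding \<Phi>_def by (intro gauss_max_difference_ge[OF N]) (simp add: R(2))
  moreover have "0 < \<gamma> * (pi/6)" using \<gamma> by simp
  ultimately show "\<Phi> 0 < \<Phi> (pi/2)" by linarith
qed

lemma integral_lborel_product:
  fixes f :: "'a::euclidean_space \<Rightarrow> real" and g :: "'b::euclidean_space \<Rightarrow> real"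
  assumes f: "integrable lborel f" and g: "integrable lborel g"
  shows "(\<integral>z. f (fst z) * g (snd z) \<partial>lborel) = integral\<^sup>L lborel f * integral\<^sup>L lborel g"
proof -
  have [measurable]: "f \<in> borel_measurable borel" "g \<in> borel_measurable borel" using f g by auto
  have int: "integrable (lborel \<Otimes>\<^sub>M lborel) (\<lambda>(x, y). f x * g y)"
  proof (rule lborel_pair.Fubini_integrable)
    show "integrable lborel (\<lambda>x. \<integral>y. norm (case (x, y) of (x, y) \<Rightarrow> f x * g y) \<partial>lborel)"
      using f by (simp add: abs_mult)
    show "AE x in lborel. integrable lborel (\<lambda>y. case (x, y) of (x, y) \<Rightarrow> f x * g y)" using g by simp
  qed measurable
  have "(\<integral>z. f (fst z) * g (snd z) \<partial>lborel) = integral\<^sup>L (lborel \<Otimes>\<^sub>M lborel) (\<lambda>(x, y). f x * g y)"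
    by (simp add: lborel_prod case_prod_beta')
  also have "\<dots> = (\<integral>x. (\<integral>y. f x * g y \<partial>lborel) \<partial>lborel)"
    using lborel_pair.integral_fst[OF int] by simp
  finally show ?thesis by simp
qed

theorem theorem3:
  fixes p q :: "nat \<Rightarrow> 'a::euclidean_space" and N :: nat
  assumes "DIM('a) \<ge> 2"
    and "\<And>i j. i < j \<Longrightarrow> j < N \<Longrightarrow> dist (p i) (p j) \<le> dist (q i) (q j)"
  shows "mean_width (convex hull (p ` {..<N})) \<le> mean_width (convex hull (q ` {..<N}))
    \<and> (\<not> congruent_config N p q \<longrightarrow>
         mean_width (convex hull (p ` {..<N})) < mean_width (convex hull (q ` {..<N})))"
proof (cases "N = 0")
  case True
  \<comment> \<open>Both hulls are empty, and the identity is a congruence of the empty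
    configurations.\<close>
  then show ?thesis by (auto simp: congruent_config_def intro!: exI[of _ id])
next
  case False
  then have N: "0 < N" by simp
  have dist: "dist (p i) (p j) \<le> dist (q i) (q j)" if "i < N" "j < N" for i j
    using assms(2)[of i j] assms(2)[of j i] that by (cases i j rule: linorder_cases) (auto simp: dist_commute)
  \<comment> \<open>Points of the doubled space: \<open>stretch\<close> takes them to
    \<open>(p i, 0)\<close> at angle 0 and to \<open>(0, q i)\<close> at angle
    \<open>pi/2\<close>.\<close>
  define x where "x i = (p i, q i)" for i
  have Q: "sq_diff (x i - x j) = (dist (q i) (q j))\<^sup>2 - (dist (p i) (p j))\<^sup>2" for i j
    by (simp add: sq_diff_def x_def dist_norm power2_norm_eq_inner)
  have pos: "0 \<le> sq_diff (x i - x j)" if "i < N" "j < N" for i j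
    unfolding Q using dist[OF that] by (simp add: power_mono)
  obtain c where c: "0 < c" "\<And>(p :: nat \<Rightarrow> 'a) N. 0 < N \<Longrightarrow>
    mean_width (convex hull (p ` {..<N})) = c * (\<integral>x. max_inner p N x * gauss x \<partial>lborel)"
    by (rule mean_width_eq_gauss) (rule that; assumption)
  define G where "G = integral\<^sup>L lborel (gauss :: 'a \<Rightarrow> real)"
  have G: "0 < G" unfolding G_def by (rule integral_pos_if_pos_on_cball) (auto simp: integrable_gauss)
  have intM: "integrable lborel (\<lambda>y. max_inner f N y * gauss y)" for f :: "nat \<Rightarrow> 'a"
    using abs_max_inner_le[OF N, of f] by (intro integrable_times_gauss[of _ 0]) auto
  \<comment> \<open>At angle 0 the maximum depends on the first component only, so the Gaussian
    integral over the second splits off as the factor \<open>G\<close>.\<close>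
  have P0: "(\<integral>z. max_inner (\<lambda>i. stretch 0 (x i)) N z * gauss z \<partial>lborel) = (\<integral>y. max_inner p N y * gauss y \<partial>lborel) * G"
  proof -
    have "max_inner (\<lambda>i. stretch 0 (x i)) N z * gauss z = (max_inner p N (fst z) * gauss (fst z)) * gauss (snd z)" for z
      using gauss_Pair[of "fst z" "snd z"] by (simp add: max_inner_def stretch_inner x_def)
    then show ?thesis unfolding G_def by (simp add: integral_lborel_product[OF intM integrable_gauss])
  qed
  have Q0: "(\<integral>z. max_inner (\<lambda>i. stretch (pi/2) (x i)) N z * gauss z \<partial>lborel) = G * (\<integral>y. max_inner q N y * gauss y \<partial>lborel)"
  proof -
    have "max_inner (\<lambda>i. stretch (pi/2) (x i)) N z * gauss z = gauss (fst z) * (max_inner q N (snd z) * gauss (snd z))" for z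
      using gauss_Pair[of "fst z" "snd z"] by (simp add: max_inner_def stretch_inner x_def)
    then show ?thesis unfolding G_def by (simp add: integral_lborel_product[OF integrable_gauss intM])
  qed
  have le: "mean_width (convex hull (p ` {..<N})) \<le> mean_width (convex hull (q ` {..<N}))"
    using gauss_max_comparison(1)[of N x, OF N pos] c G unfolding P0 Q0 by (simp add: c(2)[OF N] mult.commute)
  moreover have "mean_width (convex hull (p ` {..<N})) < mean_width (convex hull (q ` {..<N}))"
    if ncong: "\<not> congruent_config N p q"
  proof (rule ccontr)
    assume nless: "\<not> mean_width (convex hull (p ` {..<N})) < mean_width (convex hull (q ` {..<N}))"
    \<comment> \<open>An edge with positive form would make the inequality strict, which is assumed
      to fail; so the form vanishes on every edge.\<close>
    have edge: "sq_diff (x a - x b) = 0"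
      if "closed_segment (x a) (x b) face_of convex hull (x ` {..<N})" "a < N" "b < N" for a b
    proof (rule ccontr)
      assume "sq_diff (x a - x b) \<noteq> 0"
      then have "0 < sq_diff (x a - x b)" using pos[OF that(2,3)] by simp
      from gauss_max_comparison(2)[of N x, OF N pos that this] show False
        using nless c G unfolding P0 Q0 by (simp add: c(2)[OF N] mult.commute)
    qed
    \<comment> \<open>The self-adjoint map representing \<open>sq_diff\<close>, as the polytope
      argument requires.\<close>
    let ?A = "\<lambda>z::'a \<times> 'a. (- fst z, snd z)"
    have A: "linear ?A" by (rule linearI) auto
    have sym: "?A y \<bullet> z = y \<bullet> ?A z" for y z by (simp add: inner_prod_def)
    have QA: "?A z \<bullet> z = sq_diff z" for z by (simp add: inner_prod_def sq_diff_def)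
    have "sq_diff (x i - x j) = 0" if "i < N" "j < N" for i j
    proof -
      have "?A (x i - x j) \<bullet> (x i - x j) = 0"
      proof (rule quadratic_form_zero_if_zero_on_edges[OF A sym, of "x ` {..<N}"])
        show "0 \<le> ?A (y - z) \<bullet> (y - z)" if "y \<in> x ` {..<N}" "z \<in> x ` {..<N}" for y z
          using that pos unfolding QA by auto
        show "?A (y - z) \<bullet> (y - z) = 0" if "F face_of convex hull x ` {..<N}" "F = closed_segment y z"
          "y \<in> x ` {..<N}" "z \<in> x ` {..<N}" for F y z
          using that edge unfolding QA by auto
      qed (use that in auto)
      then show ?thesis unfolding QA .
    qed
    then have "dist (p i) (p j) = dist (q i) (q j)" if "i < N" "j < N" for i j
      using that unfolding Q by (simp add: power2_eq_iff_nonneg)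
    then have "congruent_config N p q"
      unfolding congruent_config_def by (rule congruent_if_dist_eq)
    then show False using ncong by simp
  qed
  ultimately show ?thesis by blast
qed

end
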